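(* Let $X\subseteq\mathbb{R}^2$ be any affine algebraic set, i.e. $X=\{(x,y): f_1(x,y)=\dots=f_k(x,y)=0\}$ for some polynomials $f_1,\dots,f_k\in\mathbb{R}[x,y]$. Then $X$ has a cell decomposition $\mathcal{A}$ with the finiteness property, and $(X,\mathcal{A})$ is a CW complex.
   Context: A cell decomposition of a set $X\subseteq\mathbb{R}^2$ is a partition of $X$ into (finitely or countably many) cells, each of which is a semi-algebraic set: 0-cells are points, 1-cells are subsets homeomorphic to an open interval, 2-cells are subsets homeomorphic to an open disk. A shortest-length curve in $X$ between two points $A,B\in X$ is a piecewise $C^2$ curve $\gamma$ from $A$ to $B$ lying entirely in $X$ whose length is minimal among all piecewise $C^2$ curves in $X$ from $A$ to $B$. A geodesic line segment (relative to the decomposition) is either a straight line segment or a connected arc contained (partially or entirely) in a 1-cell. A cell decomposition $\mathcal{A}$ of $X$ has the finiteness property if for every shortest-length curve $\gamma$ in $X$ between two points of $X$ and every cell $e\in\mathcal{A}$, the set $\gamma\cap e$ is either empty or has finitely many connected components, each of which is either a singleton or a geodesic line segment. *)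

theory Defs
  imports "HOL-Analysis.Analysis"
begin

definition is_poly2 :: "(real \<times> real \<Rightarrow> real) \<Rightarrow> bool" where
  "is_poly2 f \<longleftrightarrow> (\<exists>(c::nat \<Rightarrow> nat \<Rightarrow> real) (d::nat).
      \<forall>x y. f (x, y) = (\<Sum>i\<le>d. \<Sum>j\<le>d. c i j * x ^ i * y ^ j))"

inductive semialg :: "(real \<times> real) set \<Rightarrow> bool" where
  zero: "is_poly2 f \<Longrightarrow> semialg {p. f p = 0}"
| pos: "is_poly2 f \<Longrightarrow> semialg {p. f p > 0}"
| union: "semialg S \<Longrightarrow> semialg T \<Longrightarrow> semialg (S \<union> T)"
| compl: "semialg S \<Longrightarrow> semialg (- S)"

definition is_0cell :: "(real \<times> real) set \<Rightarrow> bool" where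
  "is_0cell e \<longleftrightarrow> (\<exists>p. e = {p})"

definition is_1cell :: "(real \<times> real) set \<Rightarrow> bool" where
  "is_1cell e \<longleftrightarrow> e homeomorphic {0<..<(1::real)}"

definition is_2cell :: "(real \<times> real) set \<Rightarrow> bool" where
  "is_2cell e \<longleftrightarrow> e homeomorphic ball (0::real \<times> real) 1"

definition cell_decomposition :: "(real \<times> real) set \<Rightarrow> (real \<times> real) set set \<Rightarrow> bool" where
  "cell_decomposition X \<A> \<longleftrightarrow>
     countable \<A> \<and> disjoint \<A> \<and> {} \<notin> \<A> \<and> \<Union>\<A> = X \<and>
     (\<forall>e\<in>\<A>. semialg e \<and> (is_0cell e \<or> is_1cell e \<or> is_2cell e))"

definition C2_on :: "real \<Rightarrow> real \<Rightarrow> (real \<Rightarrow> real \<times> real) \<Rightarrow> bool" where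
  "C2_on a b g \<longleftrightarrow> (\<exists>g1 g2.
     (\<forall>t\<in>{a..b}. (g has_vector_derivative g1 t) (at t within {a..b}) \<and>
                  (g1 has_vector_derivative g2 t) (at t within {a..b})) \<and>
     continuous_on {a..b} g2)"

definition piecewise_C2 :: "(real \<Rightarrow> real \<times> real) \<Rightarrow> bool" where
  "piecewise_C2 g \<longleftrightarrow> continuous_on {0..1} g \<and>
     (\<exists>ts::real list. sorted_wrt (<) ts \<and> ts \<noteq> [] \<and> hd ts = 0 \<and> last ts = 1 \<and>
        (\<forall>i. Suc i < length ts \<longrightarrow> C2_on (ts ! i) (ts ! Suc i) g))"

definition curve_length :: "(real \<Rightarrow> real \<times> real) \<Rightarrow> real" where
  "curve_length g = integral {0..1} (\<lambda>t. norm (vector_derivative g (at t)))"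

definition curve_in :: "(real \<times> real) set \<Rightarrow> real \<times> real \<Rightarrow> real \<times> real \<Rightarrow> (real \<Rightarrow> real \<times> real) \<Rightarrow> bool" where
  "curve_in X A B g \<longleftrightarrow> piecewise_C2 g \<and> path_image g \<subseteq> X \<and> pathstart g = A \<and> pathfinish g = B"

definition shortest_curve :: "(real \<times> real) set \<Rightarrow> real \<times> real \<Rightarrow> real \<times> real \<Rightarrow> (real \<Rightarrow> real \<times> real) \<Rightarrow> bool" where
  "shortest_curve X A B g \<longleftrightarrow> curve_in X A B g \<and>
     (\<forall>h. curve_in X A B h \<longrightarrow> curve_length g \<le> curve_length h)"

definition geodesic_segment :: "(real \<times> real) set set \<Rightarrow> (real \<times> real) set \<Rightarrow> bool" where
  "geodesic_segment \<A> C \<longleftrightarrow> connected C \<and> \<not> (\<exists>p. C \<subseteq> {p}) \<and>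
     ((\<exists>a b. a \<noteq> b \<and> C \<subseteq> {a + t *\<^sub>R (b - a) | t. True}) \<or>
      (\<exists>e\<in>\<A>. is_1cell e \<and> C \<subseteq> e))"

definition finiteness_property :: "(real \<times> real) set \<Rightarrow> (real \<times> real) set set \<Rightarrow> bool" where
  "finiteness_property X \<A> \<longleftrightarrow>
     (\<forall>A\<in>X. \<forall>B\<in>X. \<forall>g e. shortest_curve X A B g \<longrightarrow> e \<in> \<A> \<longrightarrow>
        path_image g \<inter> e = {} \<or>
        (finite (components (path_image g \<inter> e)) \<and>
         (\<forall>C\<in>components (path_image g \<inter> e). (\<exists>p. C = {p}) \<or> geodesic_segment \<A> C)))"

definition cw_complex :: "(real \<times> real) set \<Rightarrow> (real \<times> real) set set \<Rightarrow> bool" where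
  "cw_complex X \<A> \<longleftrightarrow> cell_decomposition X \<A> \<and>
     (\<forall>e\<in>\<A>. is_1cell e \<longrightarrow>
        (\<exists>\<Phi> :: real \<Rightarrow> real \<times> real. continuous_on {-1..1} \<Phi> \<and> \<Phi> ` {-1..1} \<subseteq> X \<and>
           (\<exists>\<Psi>. homeomorphism {-1<..<1} e \<Phi> \<Psi>) \<and>
           \<Phi> ` {-1, 1} \<subseteq> \<Union>{e'\<in>\<A>. is_0cell e'})) \<and>
     (\<forall>e\<in>\<A>. is_2cell e \<longrightarrow>
        (\<exists>\<Phi> :: real \<times> real \<Rightarrow> real \<times> real. continuous_on (cball 0 1) \<Phi> \<and> \<Phi> ` cball 0 1 \<subseteq> X \<and>
           (\<exists>\<Psi>. homeomorphism (ball 0 1) e \<Phi> \<Psi>) \<and>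
           \<Phi> ` sphere 0 1 \<subseteq> \<Union>{e'\<in>\<A>. is_0cell e' \<or> is_1cell e'})) \<and>
     (\<forall>e\<in>\<A>. finite {e'\<in>\<A>. e' \<inter> closure e \<noteq> {}}) \<and>
     (\<forall>S. S \<subseteq> X \<longrightarrow>
        (\<forall>e\<in>\<A>. closedin (top_of_set (X \<inter> closure e)) (S \<inter> closure e)) \<longrightarrow>
        closedin (top_of_set X) S)"

end

theory Submission
  imports Defs
    "HOL-Computational_Algebra.Polynomial_Factorial"
    "HOL-Computational_Algebra.Field_as_Ring"
begin

text \<open>If \<open>X\<close> is the whole plane, take the integer grid: shortest curves are straight segments and
  the cells are convex.

  Otherwise \<open>X\<close> is the zero set of one nonzero polynomial \<open>F\<close>, which a shear makes monic in \<open>y\<close>, so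
  that there are neither vertical components nor vertical asymptotes. Let \<open>\<H>\<close> be the set of all
  \<open>y\<close>-derivatives of the prime factors \<open>G\<close> of \<open>F\<close>. Outside finitely many vertical lines, every member of
  \<open>\<H>\<close> either vanishes identically on the zero set of \<open>G\<close> or has no zero there; so the signs of the
  members of \<open>\<H>\<close> are locally constant on \<open>X\<close>, and by Thom's lemma they separate the points of each
  fibre. Over a bounded interval between exceptional values of \<open>x\<close>, a sign condition thus cuts out of
  \<open>X\<close> the graph of a continuous function, which has limits at both ends because the fibres are finite.
  These graphs and the points of \<open>X\<close> over the exceptional values are the cells.

  In a one-dimensional decomposition the finiteness property holds for every path: the trace of a
  connected closed subset of \<open>X\<close> on a 1-cell, which is open in \<open>X\<close>, has at most two components.\<close>

subsection \<open>Bivariate polynomials\<close>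

text \<open>\<open>semialg\<close> admits only Boolean combinations of polynomial sign conditions,
  so a cell cannot simply be described as the n-th root of its fibre: that would need quantifier
  elimination. A vector of signs is such a combination from the start, which is why Thom's lemma is
  used to name the branches.

  Derivatives are taken of the prime factors because F may have repeated factors. A derivative of a
  factor \<open>G\<close>, of positive order at most its degree, is nonzero of smaller degree in y.
  So the prime \<open>G\<close> does not divide it, and non-divisibility alone confines the common
  zeros to finitely many vertical lines. Order 0 belongs to \<open>\<H>\<close> as well: it tells
  the branches of different factors apart.

  The integers are added to the exceptional abscissae. Every gap between neighbours is then bounded,
  so that edges have compact closures, and a bounded region meets only finitely many cells. This
  local finiteness yields countability, closure finiteness and the weak topology.\<close>

text \<open>The outer variable is y, the coefficients are polynomials in x. Substituting the
  constant polynomial \<open>[:y:]\<close> first makes \<open>ev\<close> a composition of ring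
  homomorphisms, so \<open>ev_simps\<close> reduces to rules for \<open>poly\<close>.\<close>

definition ev :: "real poly poly \<Rightarrow> real \<Rightarrow> real \<Rightarrow> real" where
  "ev P x y = poly (poly P [:y:]) x"

text \<open>The restriction to the vertical line over \<open>x\<close>, a univariate polynomial to
  which root counting and the mean value theorem apply. By \<open>pderiv_slice\<close>,
  \<open>pderiv\<close> on \<open>real poly poly\<close> is the partial derivative in y.\<close>

definition slice :: "real poly poly \<Rightarrow> real \<Rightarrow> real poly" where
  "slice P x = map_poly (\<lambda>c. poly c x) P"

lemma ev_simps [simp]:
  "ev 0 x y = 0" "ev 1 x y = 1" "ev (P + Q) x y = ev P x y + ev Q x y"
  "ev (P - Q) x y = ev P x y - ev Q x y" "ev (- P) x y = - ev P x y"
  "ev (P * Q) x y = ev P x y * ev Q x y" "ev (P ^ n) x y = ev P x y ^ n"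
  "ev (pCons c P) x y = poly c x + y * ev P x y" "ev (smult c P) x y = poly c x * ev P x y"
  by (simp_all add: ev_def poly_power)

lemma ev_sum: "ev (sum P A) x y = (\<Sum>a\<in>A. ev (P a) x y)"
  by (simp add: ev_def poly_sum)

lemma coeff_slice: "coeff (slice P x) i = poly (coeff P i) x"
  by (simp add: slice_def coeff_map_poly)

lemma poly_slice: "poly (slice P x) y = ev P x y"
proof (induction P)
  case (pCons c P)
  have "slice (pCons c P) x = pCons (poly c x) (slice P x)"
    by (rule poly_eqI) (auto simp: coeff_slice coeff_pCons split: nat.splits)
  then show ?case using pCons by simp
qed (simp add: slice_def)

lemma pderiv_slice: "pderiv (slice P x) = slice (pderiv P) x"
  by (rule poly_eqI) (simp add: coeff_slice coeff_pderiv algebra_simps of_nat_poly)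

lemma degree_slice_le: "degree (slice P x) \<le> degree P"
  by (rule degree_le) (simp add: coeff_slice coeff_eq_0)

lemma continuous_ev: "continuous_on UNIV (\<lambda>p. ev P (fst p) (snd p))"
proof (induction P)
  case (pCons c P)
  have "continuous_on UNIV (\<lambda>p::real\<times>real. poly c (fst p))"
    by (intro continuous_intros)
  then show ?case using pCons by (auto intro!: continuous_intros)
qed simp

lemma ev_dvd_zero: "P dvd Q \<Longrightarrow> ev P x y = 0 \<Longrightarrow> ev Q x y = 0"
  by (auto elim!: dvdE)

lemma ev_eq_sums: "ev P x y = (\<Sum>j\<le>degree P. poly (coeff P j) x * y ^ j)"
  by (simp add: ev_def poly_altdef[of P] poly_sum poly_power)

lemma is_poly2_ev: "is_poly2 (\<lambda>p. ev P (fst p) (snd p))"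
proof -
  \<comment> \<open>\<open>is_poly2\<close> bounds both exponents by one number; the sum dominates
    the degree in y and every coefficient degree in x.\<close>
  define d where "d = degree P + (\<Sum>j\<le>degree P. degree (coeff P j))"
  have dj: "degree (coeff P j) \<le> d" for j
  proof (cases "j \<le> degree P")
    case True
    then have "degree (coeff P j) \<le> (\<Sum>j\<le>degree P. degree (coeff P j))"
      by (intro member_le_sum) auto
    then show ?thesis by (simp add: d_def)
  qed (simp add: coeff_eq_0)
  have 1: "poly (coeff P j) x = (\<Sum>i\<le>d. coeff (coeff P j) i * x ^ i)" for j x
    unfolding poly_altdef using dj[of j]
    by (intro sum.mono_neutral_left) (auto simp: coeff_eq_0 not_le)
  have "ev P x y = (\<Sum>j\<le>d. poly (coeff P j) x * y ^ j)" for x y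
    unfolding ev_eq_sums
    by (intro sum.mono_neutral_left) (auto simp: coeff_eq_0 d_def not_le)
  also have "\<dots>x y = (\<Sum>j\<le>d. \<Sum>i\<le>d. coeff (coeff P j) i * x ^ i * y ^ j)" for x y
    unfolding 1 by (simp add: sum_distrib_right)
  also have "\<dots>x y = (\<Sum>i\<le>d. \<Sum>j\<le>d. coeff (coeff P j) i * x ^ i * y ^ j)" for x y
    by (rule sum.swap)
  finally show ?thesis unfolding is_poly2_def
    by (intro exI[of _ "\<lambda>i j. coeff (coeff P j) i"] exI[of _ d]) auto
qed

lemma is_poly2_imp_ev:
  assumes "is_poly2 f"
  obtains P where "\<And>x y. f (x, y) = ev P x y"
proof -
  obtain c d where c: "\<And>x y. f (x, y) = (\<Sum>i\<le>(d::nat). \<Sum>j\<le>d. c i j * x ^ i * y ^ j)"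
    using assms unfolding is_poly2_def by blast
  \<comment> \<open>In the witness \<open>[:[:0,1:]:]\<close> is the variable x and
    \<open>[:0,1:]\<close> the variable y.\<close>
  show ?thesis
    by (rule that[of "\<Sum>i\<le>d. \<Sum>j\<le>d. [:[:c i j:]:] * [:[:0,1:]:] ^ i * [:0,1:] ^ j"])
       (simp add: c ev_sum mult.assoc)
qed

section \<open>Semialgebraic sets cut out by sign conditions\<close>

lemma semialg_ev_eq: "semialg {p. ev P (fst p) (snd p) = 0}"
  and semialg_ev_pos: "semialg {p. ev P (fst p) (snd p) > 0}"
  using semialg.zero[OF is_poly2_ev] semialg.pos[OF is_poly2_ev] by auto

lemma semialg_Int: "semialg S \<Longrightarrow> semialg T \<Longrightarrow> semialg (S \<inter> T)"
  using semialg.compl[OF semialg.union[OF semialg.compl semialg.compl], of S T]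
  by simp

lemma semialg_UNIV: "semialg UNIV"
  using semialg_ev_eq[of 0] by simp

lemma semialg_INT: "finite I \<Longrightarrow> (\<And>i. i \<in> I \<Longrightarrow> semialg (S i)) \<Longrightarrow> semialg (\<Inter>i\<in>I. S i)"
  by (induction I rule: finite_induct) (auto simp: semialg_UNIV semialg_Int)

lemma semialg_ev_sgn: "semialg {p. sgn (ev P (fst p) (snd p)) = s}"
proof -
  have "semialg {p. ev P (fst p) (snd p) < 0}"
    using semialg_ev_pos[of "- P"] by simp
  \<comment> \<open>If \<open>s\<close> is not a sign the set is empty, written as the complement of
    a semialgebraic set.\<close>
  moreover have "{p. sgn (ev P (fst p) (snd p)) = s} = 
    (if s = 0 then {p. ev P (fst p) (snd p) = 0} else if s = 1 then {p. ev P (fst p) (snd p) > 0}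
     else if s = -1 then {p. ev P (fst p) (snd p) < 0} else - UNIV)"
    by (auto simp: sgn_if)
  ultimately show ?thesis
    using semialg_ev_eq[of P] semialg_ev_pos[of P] semialg.compl[OF semialg_UNIV] by simp
qed

lemma semialg_sing: "semialg {p}"
proof -
  have "{p} = {q. ev [:[:- fst p, 1:]:] (fst q) (snd q) = 0} \<inter> {q. ev [:[:- snd p:], 1:] (fst q) (snd q) = 0}"
    by (cases p) auto
  then show ?thesis by (simp only: semialg_Int semialg_ev_eq)
qed

lemma semialg_halfplanes:
  "semialg {p. fst p > a}" "semialg {p. fst p < a}" "semialg {p. snd p > a}" "semialg {p. snd p < a}"
  "semialg {p. fst p = a}" "semialg {p. snd p = a}"
proof -
  show "semialg {p. fst p > a}" using semialg_ev_pos[of "[:[:-a, 1:]:]"] by simp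
  show "semialg {p. fst p < a}" using semialg_ev_pos[of "[:[:a, -1:]:]"] by simp
  show "semialg {p. snd p > a}" using semialg_ev_pos[of "[:[:-a:], 1:]"] by simp
  show "semialg {p. snd p < a}" using semialg_ev_pos[of "[:[:a:], -1:]"] by simp
  show "semialg {p. fst p = a}" using semialg_ev_eq[of "[:[:-a, 1:]:]"] by simp
  show "semialg {p. snd p = a}" using semialg_ev_eq[of "[:[:-a:], 1:]"] by simp
qed

section \<open>Shearing a polynomial to a constant leading coefficient\<close>

lemma degree_linear_power: "degree ([:a, b:] ^ i :: 'a::comm_semiring_1 poly) \<le> i"
proof -
  have "degree ([:a, b:] ^ i) \<le> degree [:a, b:] * i" by (rule degree_power_le)
  also have "\<dots> \<le> i" by simp
  finally show ?thesis .
qed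

lemma coeff_linear_power: "coeff ([:a, b:] ^ i) i = (b::'a::comm_semiring_1) ^ i"
proof (induction i)
  case (Suc i)
  have "coeff ([:a, b:] ^ i) (Suc i) = 0" using degree_linear_power[of a b i] by (simp add: coeff_eq_0)
  then show ?case using Suc by (simp add: mult_pCons_left)
qed simp

definition shear :: "real \<Rightarrow> real \<times> real \<Rightarrow> real \<times> real" where
  "shear l p = (fst p + l * snd p, snd p)"

text \<open>If \<open>d\<close> is the total degree of \<open>P\<close>, the coefficient of y^d in
  P(x + l*y, y) is the top homogeneous part of \<open>P\<close> at (l, 1). This is a nonzero
  polynomial in \<open>l\<close>, so some \<open>l\<close> is not a root of it.\<close>

lemma ev_shear_monic:
  assumes nz: "ev P x0 y0 \<noteq> 0"
  obtains l Q c where "\<And>x y. ev Q x y = ev P (x + l * y) y" "lead_coeff Q = [:c:]" "c \<noteq> 0"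
proof -
  define n where "n = degree P"
  define m where "m = (\<Sum>j\<le>n. degree (coeff P j))"
  \<comment> \<open>The total degrees of the monomials of \<open>P\<close>.\<close>
  define D where "D = {i + j | i j. coeff (coeff P j) i \<noteq> 0}"
  have le: "j \<le> n \<and> i \<le> m" if "coeff (coeff P j) i \<noteq> 0" for i j
  proof -
    have j: "j \<le> n" using that unfolding n_def by (metis coeff_0 le_degree)
    have "i \<le> degree (coeff P j)" using that by (rule le_degree)
    also have "\<dots> \<le> m" unfolding m_def using j by (intro member_le_sum) auto
    finally show ?thesis using j by simp
  qed
  have fD: "finite D"
    by (rule finite_subset[of _ "{..m+n}"]) (auto simp: D_def dest!: le)
  have "P \<noteq> 0" using nz by auto
  then have "coeff (coeff P n) (degree (coeff P n)) \<noteq> 0" by (simp add: n_def)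
  then have "D \<noteq> {}" unfolding D_def by blast
  define d where "d = Max D"
  have "d \<in> D" using Max_in[OF fD \<open>D \<noteq> {}\<close>] by (simp add: d_def)
  then obtain i0 j0 where ij0: "d = i0 + j0" "coeff (coeff P j0) i0 \<noteq> 0" unfolding D_def by blast
  have dmax: "i + j \<le> d" if "coeff (coeff P j) i \<noteq> 0" for i j
    unfolding d_def using that by (intro Max_ge[OF fD]) (auto simp: D_def)
  \<comment> \<open>The homogeneous part of degree \<open>d\<close> at (l, 1), as a polynomial in
    \<open>l\<close>. Distinct \<open>j\<close> give distinct powers \<open>d - j\<close>, so
    nothing cancels.\<close>
  define top where "top = (\<Sum>j\<le>n. if j \<le> d then monom (coeff (coeff P j) (d - j)) (d - j) else 0)"
  have "coeff top i0 = (\<Sum>j\<le>n. if j = j0 then coeff (coeff P j0) i0 else 0)"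
    unfolding top_def coeff_sum
    using ij0 by (intro sum.cong) (auto)
  also have "\<dots> \<noteq> 0" using ij0 le[of j0 i0] by simp
  finally have "top \<noteq> 0" by auto
  then have "finite {l. poly top l = 0}" by (rule poly_roots_finite)
  then obtain l where l: "poly top l \<noteq> 0"
    using ex_new_if_finite[of "{l. poly top l = 0}"] infinite_UNIV_char_0 by auto
  \<comment> \<open>\<open>[:[:0,1:], [:l:]:]\<close> is x + l*y; the substitution is carried out
    monomial by monomial.\<close>
  define Q :: "real poly poly" where
    "Q = (\<Sum>j\<le>n. \<Sum>i\<le>m. [:[:coeff (coeff P j) i:]:] * [:[:0,1:], [:l:]:] ^ i * [:0,1:] ^ j)"
  have polyc: "poly (coeff P j) x = (\<Sum>i\<le>m. coeff (coeff P j) i * x ^ i)" for j x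
  proof -
    have "degree (coeff P j) \<le> m"
      using le[of j "degree (coeff P j)"] by (cases "coeff P j = 0") auto
    then show ?thesis unfolding poly_altdef
      by (intro sum.mono_neutral_left) (auto simp: coeff_eq_0 not_le)
  qed
  have evQ: "ev Q x y = ev P (x + l * y) y" for x y
    unfolding Q_def ev_eq_sums[of P] n_def[symmetric] polyc
    by (simp add: ev_sum sum_distrib_left mult_ac)
  have term_deg: "degree ([:[:coeff (coeff P j) i:]:] * [:[:0,1:], [:l:]:] ^ i * [:0,1:] ^ j) \<le> d" for i j
  proof (cases "coeff (coeff P j) i = 0")
    case False
    have "degree ([:[:coeff (coeff P j) i:]:] * [:[:0,1:], [:l:]:] ^ i * [:0,1:] ^ j)
       \<le> 0 + i + j"
      by (intro order.trans[OF degree_mult_le] add_mono degree_linear_power order.refl) simp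
    then show ?thesis using dmax[OF False] by simp
  qed simp
  have "degree Q \<le> d" unfolding Q_def
    by (intro degree_sum_le finite_atMost term_deg)
  \<comment> \<open>Only monomials with \<open>i + j = d\<close> reach the power \<open>d\<close> of
    y, and there x + l*y contributes \<open>l ^ i\<close>.\<close>
  moreover have cQ: "coeff Q d = [:poly top l:]"
  proof -
    have t: "coeff ([:[:coeff (coeff P j) i:]:] * [:[:0,1:], [:l:]:] ^ i * [:0,1:] ^ j) d = 
        (if i + j = d then [:coeff (coeff P j) i * l ^ i:] else 0)" for i j
    proof -
      have e: "[:[:coeff (coeff P j) i:]:] * [:[:0,1:], [:l:]:] ^ i * [:0,1:] ^ j = 
         monom [:coeff (coeff P j) i:] j * [:[:0,1:], [:l:]:] ^ i"
        by (simp add: monom_altdef mult.commute)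
      have "coeff ([:[:coeff (coeff P j) i:]:] * [:[:0,1:], [:l:]:] ^ i * [:0,1:] ^ j) d =
         (if j \<le> d then [:coeff (coeff P j) i:] * coeff ([:[:0,1:], [:l:]:] ^ i) (d - j) else 0)"
        unfolding e by (simp add: coeff_monom_mult not_le)
      also have "\<dots> = (if i + j = d then [:coeff (coeff P j) i * l ^ i:] else 0)"
      proof (cases "coeff (coeff P j) i = 0")
        case False
        then have "i + j \<le> d" by (rule dmax)
        show ?thesis
        proof (cases "i + j = d")
          case True
          then show ?thesis using coeff_linear_power[of "[:0,1:]" "[:l:]" i]
            by (auto simp: poly_const_pow)
        next
          case False
          then have "i < d - j" using \<open>i + j \<le> d\<close> by simp
          then have "coeff ([:[:0,1:], [:l:]:] ^ i) (d - j) = 0"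
            using degree_linear_power[of "[:0,1:]" "[:l:]" i] by (intro coeff_eq_0) simp
          then show ?thesis using False by simp
        qed
      qed auto
      finally show ?thesis .
    qed
    have "coeff Q d = (\<Sum>j\<le>n. \<Sum>i\<le>m. if i + j = d then [:coeff (coeff P j) i * l ^ i:] else 0)"
      unfolding Q_def coeff_sum t ..
    also have "\<dots> = (\<Sum>j\<le>n. if j \<le> d then [:coeff (coeff P j) (d - j) * l ^ (d - j):] else 0)"
    proof (intro sum.cong refl)
      fix j
      have "(\<Sum>i\<le>m. if i + j = d then [:coeff (coeff P j) i * l ^ i:] else 0) = 
        (\<Sum>i\<le>m. if i = d - j then (if j \<le> d then [:coeff (coeff P j) (d - j) * l ^ (d - j):] else 0) else 0)"
        by (intro sum.cong) auto
      also have "\<dots> = (if j \<le> d then [:coeff (coeff P j) (d - j) * l ^ (d - j):] else 0)"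
        using le[of j "d - j"] by auto
      finally show "(\<Sum>i\<le>m. if i + j = d then [:coeff (coeff P j) i * l ^ i:] else 0) = \<dots>" .
    qed
    also have "\<dots> = [:\<Sum>j\<le>n. if j \<le> d then coeff (coeff P j) (d - j) * l ^ (d - j) else 0:]"
      unfolding sum_to_poly[symmetric] by (intro sum.cong) auto
    also have "(\<Sum>j\<le>n. if j \<le> d then coeff (coeff P j) (d - j) * l ^ (d - j) else 0) = poly top l"
      unfolding top_def poly_sum by (intro sum.cong) (auto simp: poly_monom)
    finally show ?thesis .
  qed
  ultimately have "degree Q = d" using l by (metis le_antisym le_degree pCons_eq_0_iff)
  then show ?thesis using that[of Q l "poly top l"] evQ cQ l by simp
qed

section \<open>Eliminating y from a prime and a polynomial it does not divide\<close>

lemma const_poly_dvd_coeff: "[:(c::'a::comm_semiring_1):] dvd P \<Longrightarrow> c dvd coeff P i"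
  by (auto elim!: dvdE)

text \<open>Bezout over the rational functions in x, with denominators cleared: by pseudo-division,
  a nonzero element \<open>M\<close> of least degree in the ideal of \<open>G\<close> and
  \<open>H\<close> divides a multiple of each of them by a nonzero polynomial in x. Primality of
  \<open>G\<close> then forces \<open>M\<close> to be free of y.\<close>

lemma prime_combination:
  fixes G H :: "real poly poly"
  assumes G: "prime_elem G" and ndvd: "\<not> G dvd H" and dG: "degree G > 0"
  obtains A B r where "A * G + B * H = [:r:]" "r \<noteq> 0"
proof -
  define J where "J = {M. M \<noteq> 0 \<and> (\<exists>A B. M = A * G + B * H)}"
  have G0: "G \<noteq> 0" using G by auto
  have "G = 1 * G + 0 * H" "H = 0 * G + 1 * H" by simp_all
  then have GJ: "G \<in> J" and HJ: "H = 0 \<or> H \<in> J" unfolding J_def using G0 by blast+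
  obtain M where M: "M \<in> J" and min: "\<And>N. N \<in> J \<Longrightarrow> degree M \<le> degree N"
    using ex_has_least_nat[of "\<lambda>M. M \<in> J" G degree] GJ by blast
  obtain A B where AB: "M = A * G + B * H" and M0: "M \<noteq> 0" using M unfolding J_def by blast
  \<comment> \<open>The pseudo-remainder lies in the ideal again; by minimality of the degree of
    \<open>M\<close> it is zero.\<close>
  have div: "\<exists>a. a \<noteq> 0 \<and> M dvd smult a N" if N: "N = A' * G + B' * H" for N A' B'
  proof -
    obtain a q where a: "a \<noteq> 0" "smult a N = M * q + pseudo_mod N M"
      using pseudo_mod(1)[OF M0, of N] by blast
    have "pseudo_mod N M = smult a N - M * q" using a(2) by simp
    also have "\<dots> = (smult a A' - q * A) * G + (smult a B' - q * B) * H"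
      unfolding N AB by (simp add: algebra_simps smult_add_right)
    finally have "pseudo_mod N M = 0 \<or> pseudo_mod N M \<in> J" unfolding J_def by blast
    then have "pseudo_mod N M = 0"
      using pseudo_mod(2)[OF M0, of N] min[of "pseudo_mod N M"] by fastforce
    then show ?thesis using a by (intro exI[of _ a]) auto
  qed
  obtain a where a: "a \<noteq> 0" "M dvd smult a G" using div[of G 1 0] by auto
  obtain b where b: "b \<noteq> 0" "M dvd smult b H" using div[of H 0 1] by auto
  obtain N where N: "smult a G = M * N" using a by (auto elim: dvdE)
  have "G dvd M * N" unfolding N[symmetric] by (rule dvd_smult) simp
  then have "G dvd M \<or> G dvd N" using G by (simp add: prime_elem_dvd_mult_iff)
  then have "degree M = 0"
  proof
    \<comment> \<open>Then \<open>G\<close> divides \<open>smult b H\<close>, hence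
      \<open>b\<close>, which is free of y: impossible by degree.\<close>
    assume "G dvd M"
    then have "G dvd smult b H" using b dvd_trans by blast
    then have "G dvd [:b:] * H" by simp
    then have "G dvd [:b:]" using G ndvd prime_elem_dvd_mult_iff by blast
    then have "degree G \<le> degree [:b:]" using b by (intro dvd_imp_degree_le) auto
    then show ?thesis using dG by simp
  next
    \<comment> \<open>Cancelling \<open>G\<close> shows that \<open>M\<close> divides
      \<open>a\<close>, a polynomial in x alone.\<close>
    assume "G dvd N"
    then obtain K where "N = G * K" by (auto elim: dvdE)
    then have "G * [:a:] = G * (M * K)" using N by (simp add: algebra_simps)
    then have *: "[:a:] = M * K" using G0 by (metis mult_cancel_left)
    then have "M * K \<noteq> 0" using a by auto
    then have "degree (M * K) = degree M + degree K" by (intro degree_mult_eq) auto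
    then show ?thesis using * by (metis add_is_0 degree_pCons_0)
  qed
  then obtain r where "M = [:r:]" by (metis degree_eq_zeroE)
  then show ?thesis using that[of A B r] AB M0 by auto
qed

text \<open>The combination plays the part of a resultant: it vanishes at every common zero, whose
  abscissa is therefore a root of \<open>r\<close>.\<close>

lemma finite_common_zeros:
  fixes G H :: "real poly poly"
  assumes "prime_elem G" "\<not> G dvd H" "degree G > 0"
  shows "finite {x. \<exists>y. ev G x y = 0 \<and> ev H x y = 0}"
proof -
  obtain A B r where AB: "A * G + B * H = [:r:]" and r: "r \<noteq> 0"
    using prime_combination[OF assms] .
  have "poly r x = 0" if "ev G x y = 0" "ev H x y = 0" for x y
  proof -
    have "ev [:r:] x y = 0" unfolding AB[symmetric] using that by simp
    then show ?thesis by simp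
  qed
  then have "{x. \<exists>y. ev G x y = 0 \<and> ev H x y = 0} \<subseteq> {x. poly r x = 0}" by blast
  then show ?thesis using poly_roots_finite[OF r] finite_subset by blast
qed

section \<open>Thom's lemma: signs of derivatives separate roots\<close>

text \<open>Induction on the degree bound. By the induction hypothesis the derivative has no zero on
  the interval. But a zero of \<open>p\<close> between two points of equal nonzero sign forces, by
  the mean value theorem on either side, slopes of opposite signs, and so a zero of the derivative
  between them.\<close>

lemma thom_nonzero:
  fixes p :: "real poly"
  assumes "\<And>j. j \<le> n \<Longrightarrow> sgn (poly ((pderiv ^^ j) p) a) = sgn (poly ((pderiv ^^ j) p) b)"
    and "\<And>j. j \<le> n \<Longrightarrow> poly ((pderiv ^^ j) p) a \<noteq> 0"
    and "degree p \<le> n" "a \<le> y" "y \<le> b"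
  shows "poly p y \<noteq> 0"
  using assms
proof (induction n arbitrary: p y)
  case 0
  then obtain c where "p = [:c:]" by (metis degree_eq_zeroE le_zero_eq)
  then show ?case using 0(2)[of 0] by simp
next
  case (Suc n)
  have d: "poly (pderiv p) z \<noteq> 0" if "a \<le> z" "z \<le> b" for z
  proof (rule Suc.IH)
    fix j assume "j \<le> n"
    then show "sgn (poly ((pderiv ^^ j) (pderiv p)) a) = sgn (poly ((pderiv ^^ j) (pderiv p)) b)"
      "poly ((pderiv ^^ j) (pderiv p)) a \<noteq> 0"
      using Suc.prems(1,2)[of "Suc j"] by (simp_all add: funpow_swap1)
  qed (use that Suc.prems in \<open>auto simp: degree_pderiv\<close>)
  show ?case
  proof
    assume y: "poly p y = 0"
    have s: "sgn (poly p a) = sgn (poly p b)" and nz: "poly p a \<noteq> 0"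
      using Suc.prems(1,2)[of 0] by auto
    have nzb: "poly p b \<noteq> 0" using s nz by (metis sgn_zero_iff)
    have "a < y" "y < b" using y nz nzb Suc.prems(4,5) by (metis order_le_less)+
    obtain u where u: "a < u" "u < y" "poly p y - poly p a = (y - a) * poly (pderiv p) u"
      using poly_MVT[OF \<open>a < y\<close>] by blast
    obtain v where v: "y < v" "v < b" "poly p b - poly p y = (b - y) * poly (pderiv p) v"
      using poly_MVT[OF \<open>y < b\<close>] by blast
    have ne: "poly (pderiv p) u * poly (pderiv p) v < 0"
    proof -
      have "sgn (- poly p a) = sgn (poly (pderiv p) u)"
        using u y \<open>a < y\<close> by (simp add: sgn_mult)
      moreover have "sgn (poly p b) = sgn (poly (pderiv p) v)"
        using v y \<open>y < b\<close> by (simp add: sgn_mult)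
      ultimately show ?thesis using s nz nzb
        by (auto simp: sgn_if mult_less_0_iff split: if_splits)
    qed
    have "u < v" using u v by simp
    have "\<exists>z. u \<le> z \<and> z \<le> v \<and> poly (pderiv p) z = 0"
    proof (cases "poly (pderiv p) u < 0")
      case True
      then have "poly (pderiv p) v > 0" using ne by (auto simp: mult_less_0_iff)
      then show ?thesis using poly_IVT_pos[OF \<open>u < v\<close> True] by (auto intro: less_imp_le)
    next
      case False
      then have "poly (pderiv p) u > 0" "poly (pderiv p) v < 0" using ne by (auto simp: mult_less_0_iff)
      then show ?thesis using poly_IVT_neg[OF \<open>u < v\<close>] by (auto intro: less_imp_le)
    qed
    then show False using d u v by (meson order.strict_trans1 order.strict_trans2 less_imp_le)
  qed
qed

text \<open>Rolle: two distinct zeros would leave a zero of \<open>pderiv p\<close> between them,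
  against \<open>thom_nonzero\<close>.\<close>

lemma thom_unique_zero:
  fixes p :: "real poly"
  assumes s: "\<And>j. 0 < j \<Longrightarrow> j \<le> n \<Longrightarrow> sgn (poly ((pderiv ^^ j) p) a) = sgn (poly ((pderiv ^^ j) p) b)"
    and nz: "\<And>j. 0 < j \<Longrightarrow> j \<le> n \<Longrightarrow> poly ((pderiv ^^ j) p) a \<noteq> 0"
    and "degree p \<le> n" "n > 0" "poly p a = 0" "poly p b = 0" "a \<le> b"
  shows "a = b"
proof (rule ccontr)
  assume "a \<noteq> b"
  then have "a < b" using assms by simp
  obtain z where z: "a < z" "z < b" "poly p b - poly p a = (b - a) * poly (pderiv p) z"
    using poly_MVT[OF \<open>a < b\<close>] by blast
  then have "poly (pderiv p) z = 0" using assms \<open>a < b\<close> by simp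
  moreover have "poly (pderiv p) z \<noteq> 0"
  proof (rule thom_nonzero[of "n - 1"])
    fix j assume "j \<le> n - 1"
    then show "sgn (poly ((pderiv ^^ j) (pderiv p)) a) = sgn (poly ((pderiv ^^ j) (pderiv p)) b)"
      "poly ((pderiv ^^ j) (pderiv p)) a \<noteq> 0"
      using s[of "Suc j"] nz[of "Suc j"] \<open>n > 0\<close> by (simp_all add: funpow_swap1)
  qed (use assms z in \<open>auto simp: degree_pderiv\<close>)
  ultimately show False by simp
qed

section \<open>Zeros over bounded strips\<close>

text \<open>Cauchy's root bound, uniform in x: over a compact interval the lower coefficients are
  bounded, and the leading one is constant.\<close>

lemma bounded_zeros:
  assumes lc: "lead_coeff F = [:c:]" "c \<noteq> 0"
  obtains M where "\<And>x y. a \<le> x \<Longrightarrow> x \<le> b \<Longrightarrow> ev F x y = 0 \<Longrightarrow> \<bar>y\<bar> \<le> M"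
proof -
  define d where "d = degree F"
  have "\<forall>i. \<exists>K. \<forall>x\<in>{a..b}. \<bar>poly (coeff F i) x\<bar> \<le> K"
  proof
    fix i
    have "compact ((\<lambda>x. poly (coeff F i) x) ` {a..b})"
      by (intro compact_continuous_image continuous_intros) auto
    then show "\<exists>K. \<forall>x\<in>{a..b}. \<bar>poly (coeff F i) x\<bar> \<le> K"
      by (auto dest!: compact_imp_bounded simp: bounded_iff)
  qed
  then obtain K where K: "\<And>i x. x \<in> {a..b} \<Longrightarrow> \<bar>poly (coeff F i) x\<bar> \<le> K i" by metis
  define S where "S = (\<Sum>i<d. K i)"
  show ?thesis
  \<comment> \<open>If |y| > 1, each power below \<open>d\<close> is at most |y|^(d-1), so |c| |y|^d
    is at most S |y|^(d-1); the maximum with 1 covers the other y.\<close>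
  proof (rule that[of "max 1 (S / \<bar>c\<bar>)"])
    fix x y assume x: "a \<le> x" "x \<le> b" and z: "ev F x y = 0"
    show "\<bar>y\<bar> \<le> max 1 (S / \<bar>c\<bar>)"
    proof (cases "\<bar>y\<bar> \<le> 1")
      case False
      then have y1: "\<bar>y\<bar> > 1" by simp
      have split: "ev F x y = c * y ^ d + (\<Sum>i<d. poly (coeff F i) x * y ^ i)"
        unfolding ev_eq_sums d_def[symmetric] lessThan_Suc_atMost[symmetric]
        using lc by (simp add: d_def)
      have "d > 0" 
      proof (rule ccontr)
        assume "\<not> d > 0"
        then show False using split z lc by simp
      qed
      then obtain e where e: "d = Suc e" by (cases d) auto
      have "\<bar>c\<bar> * \<bar>y\<bar> ^ d = \<bar>c * y ^ d\<bar>" by (simp add: abs_mult power_abs)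
      also have "\<dots> = \<bar>\<Sum>i<d. poly (coeff F i) x * y ^ i\<bar>" using split z by linarith
      also have "\<dots> \<le> (\<Sum>i<d. \<bar>poly (coeff F i) x * y ^ i\<bar>)" by (rule sum_abs)
      also have "\<dots> \<le> (\<Sum>i<d. K i * \<bar>y\<bar> ^ e)"
      proof (rule sum_mono)
        fix i assume i: "i \<in> {..<d}"
        have "\<bar>y\<bar> ^ i \<le> \<bar>y\<bar> ^ e" using i e y1 by (intro power_increasing) auto
        moreover have "\<bar>poly (coeff F i) x\<bar> \<le> K i" using K x by simp
        ultimately show "\<bar>poly (coeff F i) x * y ^ i\<bar> \<le> K i * \<bar>y\<bar> ^ e"
          by (simp add: abs_mult power_abs) (intro mult_mono; force)
      qed
      also have "\<dots> = S * \<bar>y\<bar> ^ e" by (simp add: S_def sum_distrib_right)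
      finally have "(\<bar>c\<bar> * \<bar>y\<bar>) * \<bar>y\<bar> ^ e \<le> S * \<bar>y\<bar> ^ e" by (simp add: e algebra_simps)
      then have "\<bar>c\<bar> * \<bar>y\<bar> \<le> S" using y1 by (simp add: mult_le_cancel_right)
      then have "\<bar>y\<bar> \<le> S / \<bar>c\<bar>" using lc by (simp add: field_simps)
      then show ?thesis by simp
    qed simp
  qed
qed

text \<open>The constant leading coefficient survives restriction to a vertical line, so no slice is
  the zero polynomial.\<close>

lemma finite_slice_zeros:
  assumes lc: "lead_coeff F = [:c:]" "c \<noteq> 0"
  shows "finite {y. ev F x y = 0}"
proof -
  have "coeff (slice F x) (degree F) = c" by (simp add: coeff_slice lc)
  then have "slice F x \<noteq> 0" using lc(2) by auto
  then show ?thesis using poly_roots_finite[of "slice F x"] by (simp add: poly_slice)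
qed

subsection \<open>Cells and local finiteness\<close>

text \<open>The clauses of \<open>cw_complex\<close> apply by topological type, so the types must
  exclude each other: points by cardinality, the other two by invariance of dimension.\<close>

lemma is_0cell_not_1cell: "is_0cell e \<Longrightarrow> \<not> is_1cell e"
  and is_0cell_not_2cell: "is_0cell e \<Longrightarrow> \<not> is_2cell e"
  and is_1cell_not_2cell: "is_1cell e \<Longrightarrow> \<not> is_2cell e"
proof -
  have i2: "infinite (ball (0::real \<times> real) 1)"
    using finite_imp_not_open[of "ball (0::real \<times> real) 1"] by auto
  have sing: "finite T" if "{p} homeomorphic T" for p :: "real \<times> real" and T :: "'b::topological_space set"
    using that by (auto simp: homeomorphic_def homeomorphism_def)
  show "is_0cell e \<Longrightarrow> \<not> is_1cell e" "is_0cell e \<Longrightarrow> \<not> is_2cell e"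
    unfolding is_0cell_def is_1cell_def is_2cell_def
    using sing[of _ "{0<..<(1::real)}"] sing[of _ "ball (0::real \<times> real) 1"] i2
    by (auto simp: infinite_Ioo)
  show "is_1cell e \<Longrightarrow> \<not> is_2cell e"
  proof
    assume "is_1cell e" "is_2cell e"
    then have "ball (0::real \<times> real) 1 homeomorphic {0<..<(1::real)}"
      unfolding is_1cell_def is_2cell_def by (metis homeomorphic_sym homeomorphic_trans)
    then have "DIM(real \<times> real) = DIM(real)"
      by (rule homeomorphic_open_imp_same_dimension) auto
    then show False by simp
  qed
qed

definition locally_finite_cells :: "(real \<times> real) set set \<Rightarrow> bool" where
  "locally_finite_cells \<A> \<longleftrightarrow> (\<forall>r. finite {e\<in>\<A>. e \<inter> cball 0 r \<noteq> {}})"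

lemma locally_finite_cells_bounded:
  assumes "locally_finite_cells \<A>" "bounded B"
  shows "finite {e\<in>\<A>. e \<inter> B \<noteq> {}}"
proof -
  obtain r where "B \<subseteq> cball 0 r" using bounded_subset_ballD[OF assms(2), of 0] ball_subset_cball by blast
  then have "{e\<in>\<A>. e \<inter> B \<noteq> {}} \<subseteq> {e\<in>\<A>. e \<inter> cball 0 r \<noteq> {}}" by auto
  then show ?thesis using assms(1) finite_subset unfolding locally_finite_cells_def by blast
qed

lemma locally_finite_cells_countable:
  assumes "locally_finite_cells \<A>" "{} \<notin> \<A>"
  shows "countable \<A>"
proof -
  have "\<A> \<subseteq> (\<Union>n::nat. {e\<in>\<A>. e \<inter> cball 0 (real n) \<noteq> {}})"
  proof
    fix e assume e: "e \<in> \<A>"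
    then have "e \<noteq> {}" using assms(2) by metis
    then obtain p where p: "p \<in> e" by blast
    obtain n :: nat where "norm p \<le> real n" using real_arch_simple by blast
    then have "p \<in> e \<inter> cball 0 (real n)" using p by simp
    then show "e \<in> (\<Union>n::nat. {e\<in>\<A>. e \<inter> cball 0 (real n) \<noteq> {}})" using e by blast
  qed
  moreover have "countable (\<Union>n::nat. {e\<in>\<A>. e \<inter> cball 0 (real n) \<noteq> {}})"
    using assms(1) unfolding locally_finite_cells_def by (intro countable_UN) (auto intro: countable_finite)
  ultimately show ?thesis by (rule countable_subset)
qed

text \<open>A convergent sequence is bounded, so it meets finitely many cells and stays in a finite
  union of closed parts of \<open>S\<close>.\<close>

lemma closed_if_closed_on_cells:
  assumes lf: "locally_finite_cells \<A>" and S: "S \<subseteq> \<Union>\<A>"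
    and cl: "\<And>e. e \<in> \<A> \<Longrightarrow> closed (S \<inter> closure e)"
  shows "closed S"
  unfolding closed_sequential_limits
proof (intro allI impI)
  fix x l assume x: "(\<forall>n. x n \<in> S) \<and> x \<longlonglongrightarrow> l"
  then have "bounded (range x)" by (intro convergent_imp_bounded) auto
  then have fin: "finite {e\<in>\<A>. e \<inter> range x \<noteq> {}}" by (rule locally_finite_cells_bounded[OF lf])
  define T where "T = (\<Union>e\<in>{e\<in>\<A>. e \<inter> range x \<noteq> {}}. S \<inter> closure e)"
  have "closed T" unfolding T_def using fin cl by (intro closed_UN) auto
  moreover have "\<forall>n. x n \<in> T"
  proof
    fix n
    obtain e where "e \<in> \<A>" "x n \<in> e" using x S by blast
    then show "x n \<in> T" unfolding T_def using x closure_subset by blast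
  qed
  ultimately have "l \<in> T" using x closed_sequentially by blast
  then show "l \<in> S" by (auto simp: T_def)
qed

text \<open>Closure finiteness and the weak topology, shared by the curve and the grid.\<close>

lemma locally_finite_cells_cw:
  assumes lf: "locally_finite_cells \<A>" and X: "closed X" "\<Union>\<A> = X"
    and bd: "\<And>e. e \<in> \<A> \<Longrightarrow> bounded e"
  shows "\<forall>e\<in>\<A>. finite {e'\<in>\<A>. e' \<inter> closure e \<noteq> {}}"
    and "\<forall>S. S \<subseteq> X \<longrightarrow>
        (\<forall>e\<in>\<A>. closedin (top_of_set (X \<inter> closure e)) (S \<inter> closure e)) \<longrightarrow>
        closedin (top_of_set X) S"
proof -
  show "\<forall>e\<in>\<A>. finite {e'\<in>\<A>. e' \<inter> closure e \<noteq> {}}"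
    using locally_finite_cells_bounded[OF lf] bd by blast
  show "\<forall>S. S \<subseteq> X \<longrightarrow>
        (\<forall>e\<in>\<A>. closedin (top_of_set (X \<inter> closure e)) (S \<inter> closure e)) \<longrightarrow>
        closedin (top_of_set X) S"
  proof (intro allI impI)
    fix S assume S: "S \<subseteq> X"
      and c: "\<forall>e\<in>\<A>. closedin (top_of_set (X \<inter> closure e)) (S \<inter> closure e)"
    have "closed (S \<inter> closure e)" if "e \<in> \<A>" for e
      using c that X closed_Int closed_closure closedin_closed_trans by blast
    then have "closed S" using closed_if_closed_on_cells[OF lf] S X by blast
    then show "closedin (top_of_set X) S" using S by (simp add: closed_subset)
  qed
qed

subsection \<open>One-dimensional decompositions\<close>

text \<open>\<open>V\<close> stands for the vertices. The map is given on the closed interval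
  because \<open>cw_complex\<close> asks for a characteristic map; the two endpoints may
  coincide.\<close>

definition cell_arc :: "(real \<times> real) set \<Rightarrow> (real \<times> real) set \<Rightarrow> (real \<Rightarrow> real \<times> real) \<Rightarrow> bool" where
  "cell_arc V e \<Phi> \<longleftrightarrow> continuous_on {-1..1} \<Phi> \<and> (\<exists>\<Psi>. homeomorphism {-1<..<1} e \<Phi> \<Psi>) \<and>
     \<Phi> (-1) \<in> V \<and> \<Phi> 1 \<in> V"

text \<open>A locally finite embedded graph, with the singleton cells as vertices. All three
  conclusions follow from it, and it can be carried through the shear.\<close>

definition graph_decomposition :: "(real \<times> real) set \<Rightarrow> (real \<times> real) set set \<Rightarrow> bool" where
  "graph_decomposition X \<A> \<longleftrightarrow> closed X \<and> \<Union>\<A> = X \<and> {} \<notin> \<A> \<and> disjoint \<A> \<and> locally_finite_cells \<A> \<and>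
     (\<forall>e\<in>\<A>. semialg e \<and> ((\<exists>p. e = {p}) \<or> (\<exists>\<Phi>. cell_arc {p. {p} \<in> \<A>} e \<Phi>)))"

lemma cell_arc_is_1cell:
  assumes "cell_arc V e \<Phi>"
  shows "is_1cell e"
proof -
  have "e homeomorphic {-1<..<(1::real)}"
    using assms unfolding cell_arc_def by (metis homeomorphic_def homeomorphic_sym)
  moreover have "{-1<..<(1::real)} homeomorphic {0<..<(1::real)}"
    using homeomorphic_open_interval_UNIV[of "-1" 1] homeomorphic_open_interval_UNIV[of 0 1]
    by (meson homeomorphic_sym homeomorphic_trans less_numeral_extra(1) neg_less_0_iff_less order_less_trans zero_less_one)
  ultimately show ?thesis unfolding is_1cell_def using homeomorphic_trans by blast
qed

lemma cell_arc_image: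
  assumes "cell_arc V e \<Phi>"
  shows "\<Phi> ` {-1..1} = insert (\<Phi> (-1)) (insert (\<Phi> 1) e)"
proof -
  have "{-1..1::real} = insert (-1) (insert 1 {-1<..<1})" by auto
  moreover have "\<Phi> ` {-1<..<1} = e" using assms by (auto simp: cell_arc_def homeomorphism_def)
  ultimately show ?thesis by (metis image_insert)
qed

lemma cell_arc_closure:
  assumes "cell_arc V e \<Phi>"
  shows "closure e \<subseteq> insert (\<Phi> (-1)) (insert (\<Phi> 1) e)" "bounded e"
proof -
  have c: "compact (\<Phi> ` {-1..1})"
    using assms by (intro compact_continuous_image) (auto simp: cell_arc_def)
  have s: "e \<subseteq> \<Phi> ` {-1..1}" using cell_arc_image[OF assms] by blast
  show "closure e \<subseteq> insert (\<Phi> (-1)) (insert (\<Phi> 1) e)"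
    using closure_minimal[OF s compact_imp_closed[OF c]] cell_arc_image[OF assms] by simp
  show "bounded e" using s c compact_imp_bounded bounded_subset by blast
qed

text \<open>The complement of \<open>e\<close> in \<open>X\<close> is closed on each cell: the
  closure of another cell adds only vertices, none of which lies in \<open>e\<close>, and the
  closure of \<open>e\<close> itself adds at most its two ends.\<close>

lemma graph_decomposition_open_arc:
  assumes gd: "graph_decomposition X \<A>" and e: "e \<in> \<A>" "cell_arc {p. {p} \<in> \<A>} e \<Phi>"
  shows "openin (top_of_set X) e"
proof -
  have X: "closed X" "\<Union>\<A> = X" and dis: "disjoint \<A>" and lf: "locally_finite_cells \<A>"
    and cells: "\<And>e. e \<in> \<A> \<Longrightarrow> (\<exists>p. e = {p}) \<or> (\<exists>\<Phi>. cell_arc {p. {p} \<in> \<A>} e \<Phi>)"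
    using gd unfolding graph_decomposition_def by blast+
  have e1: "is_1cell e" by (rule cell_arc_is_1cell[OF e(2)])
  have Ve: "{p. {p} \<in> \<A>} \<inter> e = {}"
  proof (rule ccontr)
    assume "{p. {p} \<in> \<A>} \<inter> e \<noteq> {}"
    then obtain p where "{p} \<in> \<A>" "p \<in> e" by blast
    then have "e = {p}" using disjointD[OF dis _ e(1), of "{p}"] by blast
    then show False using e1 is_0cell_not_1cell by (auto simp: is_0cell_def)
  qed
  have clos: "closure e' \<subseteq> e' \<union> {p. {p} \<in> \<A>}" if "e' \<in> \<A>" for e'
    using cells[OF that] cell_arc_closure(1) by (fastforce simp: cell_arc_def)
  have VX: "{p. {p} \<in> \<A>} \<subseteq> X" using X by blast
  have "closed (X - e)"
  proof (rule closed_if_closed_on_cells[OF lf])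
    show "X - e \<subseteq> \<Union>\<A>" using X by blast
    fix e' assume e': "e' \<in> \<A>"
    show "closed ((X - e) \<inter> closure e')"
    proof (cases "e' = e")
      case True
      have "(X - e) \<inter> closure e' \<subseteq> {\<Phi> (-1), \<Phi> 1}"
        using cell_arc_closure(1)[OF e(2)] True by blast
      then show ?thesis by (meson finite.emptyI finite.insertI finite_imp_closed finite_subset)
    next
      case False
      then have "e' \<inter> e = {}" using disjointD[OF dis e' e(1)] by blast
      then have "(X - e) \<inter> closure e' = closure e'"
        using clos[OF e'] Ve VX X e' by blast
      then show ?thesis by simp
    qed
  qed
  then have "openin (top_of_set X) (X \<inter> - (X - e))"
    by (intro openin_open_Int open_Compl)
  moreover have "X \<inter> - (X - e) = e" using e X by blast
  ultimately show ?thesis by (simp only:)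
qed

text \<open>Every component contains a member of \<open>\<T>\<close>, so sending each member to the
  component of a chosen point of it reaches all components.\<close>

lemma finite_components_Union:
  assumes "finite \<T>" "\<And>T. T \<in> \<T> \<Longrightarrow> connected T" "\<Union>\<T> = S"
  shows "finite (components S)"
proof -
  have "components S \<subseteq> (\<lambda>T. connected_component_set S (SOME x. x \<in> T)) ` \<T>"
  proof
    fix C assume "C \<in> components S"
    then obtain x where x: "x \<in> S" "C = connected_component_set S x" by (auto simp: components_def)
    then obtain T where T: "T \<in> \<T>" "x \<in> T" using assms(3) by blast
    define y where "y = (SOME x. x \<in> T)"
    have y: "y \<in> T" unfolding y_def using T(2) by (rule someI)
    have "T \<subseteq> S" using T assms(3) by blast
    then have "connected_component S x y"
      unfolding connected_component_def using assms(2)[OF T(1)] T y by blast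
    then have "C = connected_component_set S y" using x(2) connected_component_eq by (metis mem_Collect_eq)
    then show "C \<in> (\<lambda>T. connected_component_set S (SOME x. x \<in> T)) ` \<T>"
      using T(1) unfolding y_def by blast
  qed
  then show ?thesis using assms(1) finite_surj by blast
qed

text \<open>If \<open>K\<close> is not contained in the arc, then between two parameters outside \<open>K\<close> there is none
  inside \<open>K\<close>, since the part of \<open>K\<close> between them would be open and closed in \<open>K\<close>.\<close>

lemma finite_components_connected_Int_arc:
  fixes K X :: "'a::t2_space set" and \<Phi> :: "real \<Rightarrow> 'a"
  assumes K: "connected K" "closed K" "K \<subseteq> X" and e: "openin (top_of_set X) e"
    and hom: "homeomorphism {-1<..<1} e \<Phi> \<Psi>"
  shows "finite (components (K \<inter> e))"
proof (cases "K \<subseteq> e")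
  case True
  then have "K \<inter> e = K" by blast
  then show ?thesis using finite_components_Union[of "{K}" K] K by simp
next
  case False
  have im: "\<Phi> ` {-1<..<1} = e" and cont: "continuous_on {-1<..<1} \<Phi>"
    and inj: "inj_on \<Phi> {-1<..<1}"
    using hom by (auto simp: homeomorphism_def intro: inj_on_inverseI)
  have gap: "\<Phi> t \<notin> K" if t: "-1 < s" "s < t" "t < u" "u < 1" and su: "\<Phi> s \<notin> K" "\<Phi> u \<notin> K" for s t u
  proof
    assume tK: "\<Phi> t \<in> K"
    have "openin (top_of_set {-1<..<1}) {s<..<u}"
      using t by (intro open_subset) auto
    then have "openin (top_of_set X) (\<Phi> ` {s<..<u})"
      using homeomorphism_imp_open_map[OF hom] e openin_trans by blast
    then have o: "openin (top_of_set K) (K \<inter> \<Phi> ` {s<..<u})"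
      using K(3) by (metis inf.absorb_iff2 openin_subtopology_Int2 subtopology_subtopology)
    have "compact (\<Phi> ` {s..u})"
      using t by (intro compact_continuous_image continuous_on_subset[OF cont]) auto
    then have "closed (K \<inter> \<Phi> ` {s..u})" using K(2) compact_imp_closed by blast
    moreover have "K \<inter> \<Phi> ` {s..u} = K \<inter> \<Phi> ` {s<..<u}"
    proof -
      have "{s..u} = insert s (insert u {s<..<u})" using t by auto
      then show ?thesis using su by auto
    qed
    ultimately have "closedin (top_of_set K) (K \<inter> \<Phi> ` {s<..<u})"
      by (metis closed_subset inf_le1)
    then have "K \<inter> \<Phi> ` {s<..<u} = {} \<or> K \<inter> \<Phi> ` {s<..<u} = K"
      using K(1) o unfolding connected_clopen by blast
    then have "K \<subseteq> \<Phi> ` {s<..<u}" using tK t by auto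
    moreover have "\<Phi> ` {s<..<u} \<subseteq> e" using im t by force
    ultimately show False using False by blast
  qed
  define S where "S = {t \<in> {-1<..<1}. \<Phi> t \<in> K}"
  have Ke: "K \<inter> e = \<Phi> ` S" unfolding S_def using im by auto
  show ?thesis
  proof (cases "S = {-1<..<1}")
    case True
    then have "K \<inter> e = e" using Ke im by simp
    moreover have "connected e" using connected_continuous_image[OF cont] im by simp
    ultimately show ?thesis using finite_components_Union[of "{e}" e] by simp
  next
    case False
    then obtain s where s: "-1 < s" "s < 1" "\<Phi> s \<notin> K" unfolding S_def by force
    have conn: "connected (\<Phi> ` T)" if "\<And>x y t. x \<in> T \<Longrightarrow> y \<in> T \<Longrightarrow> x < t \<Longrightarrow> t < y \<Longrightarrow> t \<in> T" "T \<subseteq> {-1<..<1}" for T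
    proof -
      have "is_interval T" unfolding is_interval_1 using that(1) by (metis order_le_less)
      then have "connected T" by (simp add: is_interval_connected)
      then show ?thesis using that cont by (meson connected_continuous_image continuous_on_subset)
    qed
    \<comment> \<open>On each side of the parameter \<open>s\<close> outside \<open>K\<close>, the
      parameters in \<open>K\<close> form an interval: a missing parameter between two of them
      would, together with \<open>s\<close>, enclose one of them and contradict
      \<open>gap\<close>.\<close>
    have "connected (\<Phi> ` (S \<inter> {..<s}))"
    proof (rule conn)
      fix x y t assume *: "x \<in> S \<inter> {..<s}" "y \<in> S \<inter> {..<s}" "x < t" "t < y"
      show "t \<in> S \<inter> {..<s}"
        using gap[of t y s] * s by (auto simp: S_def)
    qed (auto simp: S_def)
    moreover have "connected (\<Phi> ` (S \<inter> {s<..}))"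
    proof (rule conn)
      fix x y t assume *: "x \<in> S \<inter> {s<..}" "y \<in> S \<inter> {s<..}" "x < t" "t < y"
      show "t \<in> S \<inter> {s<..}"
        using gap[of s x t] * s by (auto simp: S_def)
    qed (auto simp: S_def)
    moreover have "K \<inter> e = \<Phi> ` (S \<inter> {..<s}) \<union> \<Phi> ` (S \<inter> {s<..})"
    proof -
      have "s \<notin> S" using s by (simp add: S_def)
      then have "S = (S \<inter> {..<s}) \<union> (S \<inter> {s<..})" by (auto simp: not_less order_le_less)
      then show ?thesis using Ke by (metis image_Un)
    qed
    ultimately show ?thesis
      using finite_components_Union[of "{\<Phi> ` (S \<inter> {..<s}), \<Phi> ` (S \<inter> {s<..})}" "K \<inter> e"] by auto
  qed
qed

lemma graph_decomposition_cell_decomposition: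
  assumes "graph_decomposition X \<A>"
  shows "cell_decomposition X \<A>"
proof -
  have "is_0cell e \<or> is_1cell e" if "(\<exists>p. e = {p}) \<or> (\<exists>\<Phi>. cell_arc {p. {p} \<in> \<A>} e \<Phi>)" for e
    using that cell_arc_is_1cell unfolding is_0cell_def by blast
  then have "\<forall>e\<in>\<A>. semialg e \<and> (is_0cell e \<or> is_1cell e \<or> is_2cell e)"
    using assms unfolding graph_decomposition_def by metis
  then show ?thesis
    using assms locally_finite_cells_countable[of \<A>]
    unfolding graph_decomposition_def cell_decomposition_def by (intro conjI) simp_all
qed

text \<open>A component of the trace on a 1-cell is a connected part of that cell, so it is a point
  or counts as a geodesic segment. What remains is the number of components, for which the arc must
  be open in \<open>X\<close>.\<close>

lemma graph_decomposition_finiteness_property: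
  assumes gd: "graph_decomposition X \<A>"
  shows "finiteness_property X \<A>"
  unfolding finiteness_property_def
proof (intro ballI allI impI disjI2)
  fix A B g e assume sc: "shortest_curve X A B g" and e: "e \<in> \<A>"
  have K: "connected (path_image g)" "closed (path_image g)" "path_image g \<subseteq> X"
    using sc unfolding shortest_curve_def curve_in_def piecewise_C2_def
    by (auto simp: path_def[symmetric] connected_path_image closed_path_image)
  consider p where "e = {p}" | \<Phi> where "cell_arc {p. {p} \<in> \<A>} e \<Phi>"
    using gd e unfolding graph_decomposition_def by blast
  then show "finite (components (path_image g \<inter> e)) \<and>
     (\<forall>C\<in>components (path_image g \<inter> e). (\<exists>p. C = {p}) \<or> geodesic_segment \<A> C)"
  proof cases
    case 1
    then have "components (path_image g \<inter> e) \<subseteq> {{p}}"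
      using in_components_subset[of _ "path_image g \<inter> e"] in_components_nonempty[of _ "path_image g \<inter> e"] by blast
    then show ?thesis using finite_subset by blast
  next
    case 2
    obtain \<Psi> where "homeomorphism {-1<..<1} e \<Phi> \<Psi>" using 2 unfolding cell_arc_def by blast
    then have "finite (components (path_image g \<inter> e))"
      using finite_components_connected_Int_arc[OF K graph_decomposition_open_arc[OF gd e 2]] by blast
    moreover have "(\<exists>p. C = {p}) \<or> geodesic_segment \<A> C" if C: "C \<in> components (path_image g \<inter> e)" for C
    proof -
      have "connected C" "C \<subseteq> e" "C \<noteq> {}"
        using in_components_connected[OF C] in_components_subset[OF C] in_components_nonempty[OF C] by auto
      then show ?thesis unfolding geodesic_segment_def using e cell_arc_is_1cell[OF 2] by blast
    qed
    ultimately show ?thesis by blast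
  qed
qed

lemma graph_decomposition_cw_complex:
  assumes gd: "graph_decomposition X \<A>"
  shows "cw_complex X \<A>"
proof -
  have X: "closed X" "\<Union>\<A> = X" and lf: "locally_finite_cells \<A>"
    and cells: "\<And>e. e \<in> \<A> \<Longrightarrow> (\<exists>p. e = {p}) \<or> (\<exists>\<Phi>. cell_arc {p. {p} \<in> \<A>} e \<Phi>)"
    using gd unfolding graph_decomposition_def by blast+
  have bd: "bounded e" if "e \<in> \<A>" for e
    using cells[OF that] cell_arc_closure(2) by fastforce
  have 1: "\<exists>\<Phi> :: real \<Rightarrow> real \<times> real. continuous_on {-1..1} \<Phi> \<and> \<Phi> ` {-1..1} \<subseteq> X \<and>
           (\<exists>\<Psi>. homeomorphism {-1<..<1} e \<Phi> \<Psi>) \<and>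
           \<Phi> ` {-1, 1} \<subseteq> \<Union>{e'\<in>\<A>. is_0cell e'}" if e: "e \<in> \<A>" "is_1cell e" for e
  proof -
    obtain \<Phi> where \<Phi>: "cell_arc {p. {p} \<in> \<A>} e \<Phi>"
      using cells[OF e(1)] e(2) is_0cell_not_1cell by (auto simp: is_0cell_def)
    have "{p. {p} \<in> \<A>} \<subseteq> \<Union>{e'\<in>\<A>. is_0cell e'}" by (auto simp: is_0cell_def)
    moreover have "e \<subseteq> X" "{p. {p} \<in> \<A>} \<subseteq> X" using e X by blast+
    then have "\<Phi> ` {-1..1} \<subseteq> X"
      using \<Phi> unfolding cell_arc_image[OF \<Phi>] cell_arc_def by blast
    ultimately show ?thesis using \<Phi> unfolding cell_arc_def by (intro exI[of _ \<Phi>]) auto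
  qed
  \<comment> \<open>This makes the clause on 2-cells vacuous.\<close>
  have 2: "\<not> is_2cell e" if "e \<in> \<A>" for e
    using cells[OF that] cell_arc_is_1cell is_1cell_not_2cell is_0cell_not_2cell by (auto simp: is_0cell_def)
  show ?thesis
    unfolding cw_complex_def
    by (intro conjI ballI impI graph_decomposition_cell_decomposition[OF gd])
       (use 1 2 locally_finite_cells_cw[OF lf X bd] in simp_all)
qed

text \<open>Local finiteness speaks of balls, hence \<open>lip\<close>: an image cell meeting a ball
  comes from a cell meeting the bounded image of that ball under \<open>h'\<close>.\<close>

lemma graph_decomposition_homeomorphism_image:
  assumes gd: "graph_decomposition X \<A>" and hom: "homeomorphism UNIV UNIV h h'"
    and lip: "\<And>B. bounded B \<Longrightarrow> bounded (h' ` B)"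
    and sa: "\<And>S. semialg S \<Longrightarrow> semialg (h ` S)"
  shows "graph_decomposition (h ` X) ((`) h ` \<A>)"
proof -
  have X: "closed X" "\<Union>\<A> = X" "{} \<notin> \<A>" and dis: "disjoint \<A>" and lf: "locally_finite_cells \<A>"
    and cells: "\<And>e. e \<in> \<A> \<Longrightarrow> semialg e \<and> ((\<exists>p. e = {p}) \<or> (\<exists>\<Phi>. cell_arc {p. {p} \<in> \<A>} e \<Phi>))"
    using gd unfolding graph_decomposition_def by blast+
  have hh: "h' (h x) = x" "h (h' x) = x" for x
    using homeomorphism_apply1[OF hom] homeomorphism_apply2[OF hom] by simp_all
  have ch: "continuous_on S h" "continuous_on S h'" for S
    using hom continuous_on_subset unfolding homeomorphism_def by blast+
  have inj: "inj h" using hh by (metis injI)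
  have "closed (h ` X)"
  proof -
    have "h ` X = h' -` X"
    proof
      show "h' -` X \<subseteq> h ` X"
      proof
        fix x assume "x \<in> h' -` X"
        then have "h (h' x) \<in> h ` X" by simp
        then show "x \<in> h ` X" by (simp only: hh)
      qed
    qed (auto simp only: hh vimage_eq image_iff)
    then show ?thesis using X(1) ch(2)[of UNIV] by (simp add: closed_vimage)
  qed
  moreover have "\<Union>((`) h ` \<A>) = h ` X" using X by blast
  moreover have "{} \<notin> (`) h ` \<A>" using X by auto
  moreover have "disjoint ((`) h ` \<A>)"
    unfolding disjoint_def
  proof (intro ballI impI)
    fix a b assume ab: "a \<in> (`) h ` \<A>" "b \<in> (`) h ` \<A>" "a \<noteq> b"
    then obtain a' b' where "a = h ` a'" "b = h ` b'" "a' \<in> \<A>" "b' \<in> \<A>" by blast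
    moreover then have "a' \<inter> b' = {}" using ab dis by (metis disjointD)
    ultimately show "a \<inter> b = {}" using inj by (metis image_Int image_empty)
  qed
  moreover have "locally_finite_cells ((`) h ` \<A>)"
    unfolding locally_finite_cells_def
  proof
    fix r
    have "{e \<in> (`) h ` \<A>. e \<inter> cball 0 r \<noteq> {}} \<subseteq> (`) h ` {e\<in>\<A>. e \<inter> h' ` cball 0 r \<noteq> {}}"
    proof
      fix e' assume "e' \<in> {e \<in> (`) h ` \<A>. e \<inter> cball 0 r \<noteq> {}}"
      then obtain e x where e: "e' = h ` e" "e \<in> \<A>" "x \<in> e" "h x \<in> cball 0 r" by blast
      then have "h' (h x) \<in> h' ` cball 0 r" by blast
      then have "x \<in> e \<inter> h' ` cball 0 r" using e hh by simp
      then show "e' \<in> (`) h ` {e\<in>\<A>. e \<inter> h' ` cball 0 r \<noteq> {}}" using e by blast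
    qed
    then show "finite {e \<in> (`) h ` \<A>. e \<inter> cball 0 r \<noteq> {}}"
      by (rule finite_subset) (intro finite_imageI locally_finite_cells_bounded[OF lf] lip bounded_cball)
  qed
  moreover have "\<forall>e\<in>(`) h ` \<A>. semialg e \<and> ((\<exists>p. e = {p}) \<or> (\<exists>\<Phi>. cell_arc {p. {p} \<in> (`) h ` \<A>} e \<Phi>))"
  proof
    fix e assume "e \<in> (`) h ` \<A>"
    then obtain e' where e': "e = h ` e'" "e' \<in> \<A>" by blast
    have "(\<exists>p. e' = {p}) \<or> (\<exists>\<Phi>. cell_arc {p. {p} \<in> \<A>} e' \<Phi>)" using cells e' by blast
    then have "(\<exists>p. e = {p}) \<or> (\<exists>\<Phi>. cell_arc {p. {p} \<in> (`) h ` \<A>} e \<Phi>)"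
    proof (elim disjE exE)
      fix \<Phi> assume \<Phi>: "cell_arc {p. {p} \<in> \<A>} e' \<Phi>"
      then obtain \<Psi> where \<Psi>: "homeomorphism {-1<..<1} e' \<Phi> \<Psi>" unfolding cell_arc_def by blast
      have "homeomorphism e' e h h'"
        using homeomorphism_of_subsets[OF hom subset_UNIV subset_UNIV] e'(1) by metis
      then have "homeomorphism {-1<..<1} e (h \<circ> \<Phi>) (\<Psi> \<circ> h')"
        by (rule homeomorphism_compose[OF \<Psi>])
      moreover have "continuous_on {-1..1} (h \<circ> \<Phi>)"
        using \<Phi> ch unfolding cell_arc_def by (intro continuous_on_compose) auto
      moreover have "{h p} \<in> (`) h ` \<A>" if "{p} \<in> \<A>" for p
        using imageI[OF that, of "(`) h"] by simp
      ultimately have "cell_arc {p. {p} \<in> (`) h ` \<A>} e (h \<circ> \<Phi>)"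
        using \<Phi> unfolding cell_arc_def by auto
      then show ?thesis by blast
    qed (use e' in auto)
    moreover have "semialg e" unfolding e'(1) using sa cells e'(2) by simp
    ultimately show "semialg e \<and> ((\<exists>p. e = {p}) \<or> (\<exists>\<Phi>. cell_arc {p. {p} \<in> (`) h ` \<A>} e \<Phi>))"
      by (rule conjI[rotated])
  qed
  ultimately show ?thesis unfolding graph_decomposition_def by (intro conjI)
qed

subsection \<open>Decomposing a branched curve\<close>

text \<open>If \<open>f\<close> had no limit at \<open>e\<close>, the intermediate value theorem would make every value between two
  cluster values a cluster value.\<close>

lemma tendsto_if_finite_cluster_values:
  fixes f :: "real \<Rightarrow> real"
  assumes S: "convex S" "e \<in> closure S" and cont: "continuous_on S f" and bd: "bounded (f ` S)"
    and Z: "finite Z" "\<And>x c. (\<And>n::nat. x n \<in> S) \<Longrightarrow> x \<longlonglongrightarrow> e \<Longrightarrow> (\<lambda>n. f (x n)) \<longlonglongrightarrow> c \<Longrightarrow> c \<in> Z"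
  obtains l where "l \<in> Z" "(f \<longlongrightarrow> l) (at e within S)"
proof -
  have sub: "\<exists>c r. strict_mono r \<and> c \<in> Z \<and> (\<lambda>n. f (x (r n))) \<longlonglongrightarrow> c"
    if x: "\<And>n. x n \<in> S" "x \<longlonglongrightarrow> e" for x :: "nat \<Rightarrow> real"
  proof -
    have "bounded (range (\<lambda>n. f (x n)))" by (rule bounded_subset[OF bd]) (use x in auto)
    then obtain c r where r: "strict_mono (r::nat\<Rightarrow>nat)" "((\<lambda>n. f (x n)) \<circ> r) \<longlonglongrightarrow> c"
      using bounded_imp_convergent_subsequence by blast
    have "(\<lambda>n. x (r n)) \<longlonglongrightarrow> e" using LIMSEQ_subseq_LIMSEQ[OF x(2) r(1)] by (simp add: o_def)
    then have "c \<in> Z" using Z(2)[of "\<lambda>n. x (r n)" c] x r by (simp add: o_def)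
    then show ?thesis using r by (auto simp: o_def)
  qed
  obtain s where s: "\<And>n. s n \<in> S" "s \<longlonglongrightarrow> e" using S(2) closure_sequential by metis
  obtain l r where r: "strict_mono (r::nat\<Rightarrow>nat)" "l \<in> Z" "(\<lambda>n. f (s (r n))) \<longlonglongrightarrow> l"
    using sub[OF s] by blast
  have sr: "(\<lambda>n. s (r n)) \<longlonglongrightarrow> e" using LIMSEQ_subseq_LIMSEQ[OF s(2) r(1)] by (simp add: o_def)
  have "(f \<longlongrightarrow> l) (at e within S)"
  proof (rule ccontr)
    assume "\<not> (f \<longlongrightarrow> l) (at e within S)"
    then obtain \<epsilon> where \<epsilon>: "\<epsilon> > 0" and far: "\<And>d. d > 0 \<Longrightarrow> \<exists>x\<in>S. dist x e < d \<and> dist (f x) l \<ge> \<epsilon>"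
      unfolding Lim_within by (meson not_less)
    \<comment> \<open>Arbitrarily near \<open>e\<close>, \<open>f\<close> comes closer than
      \<open>t\<close> to \<open>l\<close> along the sequence and is at least
      \<open>\<epsilon>\<close> away elsewhere. Using the distance to \<open>l\<close> spares a
      distinction between values above and below \<open>l\<close>.\<close>
    have "\<exists>c\<in>Z. dist c l = t" if t: "0 < t" "t < \<epsilon>" for t
    proof -
      have "\<exists>z\<in>S. dist z e < inverse (real (Suc n)) \<and> dist (f z) l = t" for n
      proof -
        define d where "d = inverse (real (Suc n))"
        have d: "d > 0" by (simp add: d_def)
        obtain x where x: "x \<in> S" "dist x e < d" "dist (f x) l \<ge> \<epsilon>" using far[OF d] by blast
        have "eventually (\<lambda>m. dist (s (r m)) e < d \<and> dist (f (s (r m))) l < t) sequentially"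
          using tendstoD[OF sr d] tendstoD[OF r(3) t(1)] by (rule eventually_conj)
        then obtain m where m: "dist (s (r m)) e < d" "dist (f (s (r m))) l < t"
          using eventually_happens' sequentially_bot by blast
        define T where "T = S \<inter> ball e d"
        have "connected T" unfolding T_def using S by (intro convex_connected convex_Int convex_ball)
        moreover have "continuous_on T (\<lambda>z. dist (f z) l)"
          unfolding T_def by (intro continuous_intros continuous_on_subset[OF cont]) auto
        ultimately have "connected ((\<lambda>z. dist (f z) l) ` T)" by (rule connected_continuous_image[rotated])
        moreover have "dist (f x) l \<in> (\<lambda>z. dist (f z) l) ` T" "dist (f (s (r m))) l \<in> (\<lambda>z. dist (f z) l) ` T"
          using x m s by (auto simp: T_def dist_commute)
        ultimately have "t \<in> (\<lambda>z. dist (f z) l) ` T"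
          using connectedD_interval[of "(\<lambda>z. dist (f z) l) ` T"] x(3) m(2) t
          by (meson less_imp_le order.trans)
        then show ?thesis unfolding T_def d_def by (auto simp: dist_commute)
      qed
      then obtain z where z: "\<And>n. z n \<in> S" "\<And>n. dist (z n) e < inverse (real (Suc n))" "\<And>n. dist (f (z n)) l = t"
        by metis
      have "z \<longlonglongrightarrow> e"
      proof (subst tendsto_dist_iff, rule tendsto_sandwich[OF _ _ tendsto_const LIMSEQ_inverse_real_of_nat])
        show "eventually (\<lambda>n. dist (z n) e \<le> inverse (real (Suc n))) sequentially"
          by (rule always_eventually) (rule allI, rule less_imp_le, rule z(2))
      qed simp
      then obtain c q where q: "strict_mono (q::nat\<Rightarrow>nat)" "c \<in> Z" "(\<lambda>n. f (z (q n))) \<longlonglongrightarrow> c"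
        using sub[of z] z(1) by blast
      have "(\<lambda>n. dist (f (z (q n))) l) \<longlonglongrightarrow> dist c l" using q(3) by (intro tendsto_intros)
      then have "(\<lambda>n::nat. t) \<longlonglongrightarrow> dist c l" unfolding z(3) .
      then have "dist c l = t" using LIMSEQ_unique tendsto_const by blast
      then show ?thesis using q(2) by blast
    qed
    then have "{0<..<\<epsilon>} \<subseteq> (\<lambda>c. dist c l) ` Z" by force
    then show False using Z(1) \<epsilon> infinite_Ioo finite_surj by blast
  qed
  then show ?thesis using that r(2) by blast
qed

lemma dist_Pair_le: "dist (x, y) (x', y') \<le> dist x x' + dist (y::real) y'" for x :: real
  using sqrt_sum_squares_le_sum_abs[of "x - x'" "y - y'"]
  by (simp add: dist_prod_def dist_real_def)

text \<open>What the topological construction needs from the algebra: \<open>C\<close> holds the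
  exceptional abscissae and \<open>L\<close> names the branch through a point.
  \<open>label_inj\<close> says that a branch meets a fibre at most once, \<open>branch\<close> that
  it continues sideways, \<open>locally_const\<close> that it keeps its name meanwhile.\<close>

locale branched_curve =
  fixes X :: "(real \<times> real) set" and C :: "real set" and L :: "real \<times> real \<Rightarrow> 'l"
  assumes closed_X: "closed X"
    and bounded_strip: "bounded (X \<inter> {a..b} \<times> UNIV)"
    and finite_fibre: "finite {y. (x, y) \<in> X}"
    and Ints_subset: "\<int> \<subseteq> C"
    and finite_C: "finite (C \<inter> {a..b})"
    and locally_const: "p \<in> X \<Longrightarrow> fst p \<notin> C \<Longrightarrow> eventually (\<lambda>q. q \<in> X \<longrightarrow> L q = L p) (nhds p)"
    and label_inj: "(x, y) \<in> X \<Longrightarrow> (x, y') \<in> X \<Longrightarrow> x \<notin> C \<Longrightarrow> L (x, y) = L (x, y') \<Longrightarrow> y = y'"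
    and branch: "(x, y) \<in> X \<Longrightarrow> x \<notin> C \<Longrightarrow> \<epsilon> > 0 \<Longrightarrow>
      eventually (\<lambda>x'. \<exists>y'. (x', y') \<in> X \<and> dist y' y < \<epsilon>) (nhds x)"
    and label_semialg: "p \<in> X \<Longrightarrow> semialg {q \<in> X. L q = L p}"
begin

definition gap :: "real \<Rightarrow> real \<Rightarrow> bool" where
  "gap a b \<longleftrightarrow> a \<in> C \<and> b \<in> C \<and> a < b \<and> C \<inter> {a<..<b} = {}"

definition piece :: "real \<Rightarrow> real \<Rightarrow> 'l \<Rightarrow> (real \<times> real) set" where
  "piece a b l = {p \<in> X. a < fst p \<and> fst p < b \<and> L p = l}"

lemma gap_exists:
  assumes "x \<notin> C"
  obtains a b where "gap a b" "a < x" "x < b"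
proof -
  let ?u = "real_of_int \<lfloor>x\<rfloor>"
  have u: "?u \<in> C" "?u + 1 \<in> C" using Ints_subset Ints_of_int[of "\<lfloor>x\<rfloor>"] Ints_of_int[of "\<lfloor>x\<rfloor> + 1"] by auto
  have ux: "?u \<le> x" "x \<le> ?u + 1" by linarith+
  \<comment> \<open>Both ends of the unit interval around \<open>x\<close> are integers, hence in
    \<open>C\<close>, so the two sets are nonempty.\<close>
  define a where "a = Max (C \<inter> {?u..x})"
  define b where "b = Min (C \<inter> {x..?u + 1})"
  have ne: "C \<inter> {?u..x} \<noteq> {}" "C \<inter> {x..?u + 1} \<noteq> {}" using u ux by auto
  have a: "a \<in> C \<inter> {?u..x}" unfolding a_def by (rule Max_in[OF finite_C ne(1)])
  have b: "b \<in> C \<inter> {x..?u + 1}" unfolding b_def by (rule Min_in[OF finite_C ne(2)])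
  have amax: "c \<le> a" if "c \<in> C" "?u \<le> c" "c \<le> x" for c
    unfolding a_def using that by (intro Max_ge finite_C) auto
  have bmin: "b \<le> c" if "c \<in> C" "x \<le> c" "c \<le> ?u + 1" for c
    unfolding b_def using that by (intro Min_le finite_C) auto
  have ab: "a < x" "x < b" using a b assms by (auto simp: order_le_less)
  have "C \<inter> {a<..<b} = {}"
  proof (rule ccontr)
    assume "C \<inter> {a<..<b} \<noteq> {}"
    then obtain c where c: "c \<in> C" "a < c" "c < b" by auto
    show False
    proof (cases "c \<le> x")
      case True
      then show ?thesis using amax[of c] c a by auto
    next
      case False
      then show ?thesis using bmin[of c] c b by auto
    qed
  qed
  then show ?thesis using that[of a b] a b ab unfolding gap_def by auto
qed

lemma gap_unique:
  assumes "gap a b" "gap a' b'" "a < x" "x < b" "a' < x" "x < b'"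
  shows "a = a' \<and> b = b'"
proof -
  have *: "a' \<notin> {a<..<b}" "b' \<notin> {a<..<b}" "a \<notin> {a'<..<b'}" "b \<notin> {a'<..<b'}"
    using assms unfolding gap_def by blast+
  show ?thesis using * assms by auto
qed

text \<open>A longer gap would contain an integer. The bound keeps the gaps of all edges meeting a
  ball inside a fixed interval.\<close>

lemma gap_length: "gap a b \<Longrightarrow> b \<le> a + 1"
proof (rule ccontr)
  assume g: "gap a b" "\<not> b \<le> a + 1"
  have "real_of_int (\<lfloor>a\<rfloor> + 1) \<in> C" using Ints_subset Ints_of_int by blast
  moreover have "real_of_int (\<lfloor>a\<rfloor> + 1) \<in> {a<..<b}" using g(2) by (simp; linarith)
  ultimately show False using g unfolding gap_def by blast
qed

lemma gap_not_C: "gap a b \<Longrightarrow> a < x \<Longrightarrow> x < b \<Longrightarrow> x \<notin> C"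
  unfolding gap_def by auto

section \<open>Pieces as graphs of continuous functions over gaps\<close>

lemma piece_near:
  assumes g: "gap a b" and q: "(x, y) \<in> piece a b l" and \<epsilon>: "\<epsilon> > 0"
  shows "eventually (\<lambda>x'. \<exists>y'. (x', y') \<in> piece a b l \<and> dist y' y < \<epsilon>) (nhds x)"
proof -
  have q': "(x, y) \<in> X" "a < x" "x < b" "L (x, y) = l" using q by (auto simp: piece_def)
  have xC: "x \<notin> C" using gap_not_C[OF g] q' by blast
  have "eventually (\<lambda>q. q \<in> X \<longrightarrow> L q = l) (nhds (x, y))"
    using locally_const[OF q'(1)] xC q' by simp
  then obtain d where d: "d > 0" "\<And>q. dist q (x, y) < d \<Longrightarrow> q \<in> X \<Longrightarrow> L q = l"
    unfolding eventually_nhds_metric by blast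
  \<comment> \<open>Moving by less than \<open>d/2\<close> in each coordinate stays within the
    distance \<open>d\<close> at which the label is constant.\<close>
  have "eventually (\<lambda>x'. \<exists>y'. (x', y') \<in> X \<and> dist y' y < min \<epsilon> (d/2)) (nhds x)"
    using branch[OF q'(1) xC, of "min \<epsilon> (d/2)"] d \<epsilon> by simp
  moreover have "eventually (\<lambda>x'. x' \<in> {a<..<b}) (nhds x)"
    using q' by (intro eventually_nhds_in_open) auto
  moreover have "eventually (\<lambda>x'. dist x' x < d/2) (nhds x)"
    using d unfolding eventually_nhds_metric by (intro exI[of _ "d/2"]) auto
  ultimately show ?thesis
  proof eventually_elim
    case (elim x')
    then obtain y' where y': "(x', y') \<in> X" "dist y' y < min \<epsilon> (d/2)" by blast
    have "dist (x', y') (x, y) < d" using dist_Pair_le[of x' y' x y] elim y' by simp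
    then have "L (x', y') = l" using d(2) y' by blast
    then show ?case using elim y' by (intro exI[of _ y']) (auto simp: piece_def)
  qed
qed

lemma piece_unique:
  "gap a b \<Longrightarrow> (x, y) \<in> piece a b l \<Longrightarrow> (x, y') \<in> piece a b l \<Longrightarrow> y = y'"
  using label_inj[of x y y'] gap_not_C[of a b x] by (auto simp: piece_def)

text \<open>The projection is open in the connected gap by \<open>piece_near\<close>. It is closed
  there because points of the piece over convergent abscissae accumulate, by boundedness of the
  strip, at a point of \<open>X\<close> over the gap, and the locally constant label of that point
  must be \<open>l\<close>.\<close>

lemma piece_projection:
  assumes g: "gap a b" and ne: "piece a b l \<noteq> {}"
  shows "fst ` piece a b l = {a<..<b}"
proof -
  define D where "D = fst ` piece a b l"
  have sub: "D \<subseteq> {a<..<b}" unfolding D_def piece_def by auto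
  have "open D"
  proof (subst open_subopen, rule ballI)
    fix x assume "x \<in> D"
    then obtain y where y: "(x, y) \<in> piece a b l" unfolding D_def by auto
    have "eventually (\<lambda>x'. x' \<in> D) (nhds x)"
      using piece_near[OF g y zero_less_one]
    proof (rule eventually_mono)
      fix x' assume "\<exists>y'. (x', y') \<in> piece a b l \<and> dist y' y < 1"
      then obtain y' where "(x', y') \<in> piece a b l" by blast
      then have "fst (x', y') \<in> D" unfolding D_def by (rule imageI)
      then show "x' \<in> D" by simp
    qed
    then show "\<exists>T. open T \<and> x \<in> T \<and> T \<subseteq> D" unfolding eventually_nhds by auto
  qed
  moreover have "D = {a<..<b} \<inter> closure D"
  proof (intro equalityI subsetI)
    fix x assume x: "x \<in> {a<..<b} \<inter> closure D"
    then obtain u where u: "\<And>n. u n \<in> D" "u \<longlonglongrightarrow> x" using closure_sequential by (metis IntD2)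
    have "\<exists>y. (u n, y) \<in> piece a b l" for n using u(1)[of n] unfolding D_def by force
    then obtain y where y: "\<And>n. (u n, y n) \<in> piece a b l" by metis
    have "bounded (range (\<lambda>n. (u n, y n)))"
    proof (rule bounded_subset[OF bounded_strip[of a b]], rule image_subsetI)
      fix n
      have "(u n, y n) \<in> X" "a < u n" "u n < b" using y[of n] by (simp_all add: piece_def)
      then show "(u n, y n) \<in> X \<inter> {a..b} \<times> UNIV" by simp
    qed
    then obtain q r where r: "strict_mono (r::nat\<Rightarrow>nat)" "((\<lambda>n. (u n, y n)) \<circ> r) \<longlonglongrightarrow> q"
      using bounded_imp_convergent_subsequence by blast
    have lim: "(\<lambda>n. (u (r n), y (r n))) \<longlonglongrightarrow> q" using r(2) by (simp add: o_def)
    have "(\<lambda>n. u (r n)) \<longlonglongrightarrow> fst q" using tendsto_fst[OF lim] by simp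
    moreover have "(\<lambda>n. u (r n)) \<longlonglongrightarrow> x" using LIMSEQ_subseq_LIMSEQ[OF u(2) r(1)] by (simp add: o_def)
    ultimately have fq: "fst q = x" using LIMSEQ_unique by blast
    have qX: "q \<in> X"
      using closed_sequentially[OF closed_X _ lim] y by (auto simp: piece_def)
    have "fst q \<notin> C" using gap_not_C[OF g, of x] x fq by simp
    then have "eventually (\<lambda>q'. q' \<in> X \<longrightarrow> L q' = L q) (nhds q)" using locally_const[OF qX] by blast
    then have "eventually (\<lambda>n. (u (r n), y (r n)) \<in> X \<longrightarrow> L (u (r n), y (r n)) = L q) sequentially"
      using lim unfolding filterlim_iff by blast
    then obtain n where "(u (r n), y (r n)) \<in> X \<longrightarrow> L (u (r n), y (r n)) = L q"
      using eventually_happens' sequentially_bot by blast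
    then have "L q = l" using y[of "r n"] by (auto simp: piece_def)
    then have "q \<in> piece a b l" using qX fq x by (auto simp: piece_def)
    then show "x \<in> D" unfolding D_def using fq by blast
  qed (use sub closure_subset in auto)
  then have "closedin (top_of_set {a<..<b}) D" by (metis closed_closure closedin_closed_Int)
  moreover have "openin (top_of_set {a<..<b}) D" using \<open>open D\<close> sub by (rule open_subset[rotated])
  moreover have "connected {a<..<b}" by (simp add: convex_connected)
  ultimately have "D = {} \<or> D = {a<..<b}" unfolding connected_clopen by blast
  then show ?thesis using ne unfolding D_def by blast
qed

text \<open>Continuity is \<open>piece_near\<close> read through uniqueness: the nearby point that
  it provides over x' can only be the one at height \<open>\<xi> x'\<close>.\<close>

lemma piece_graph:
  assumes g: "gap a b" and ne: "piece a b l \<noteq> {}"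
  obtains \<xi> where "continuous_on {a<..<b} \<xi>" "piece a b l = (\<lambda>x. (x, \<xi> x)) ` {a<..<b}"
proof -
  have "\<exists>y. (x, y) \<in> piece a b l" if "x \<in> {a<..<b}" for x
    using that unfolding piece_projection[OF g ne, symmetric] by force
  then obtain \<xi> where \<xi>: "\<And>x. x \<in> {a<..<b} \<Longrightarrow> (x, \<xi> x) \<in> piece a b l" by metis
  have un: "y = \<xi> x" if "(x, y) \<in> piece a b l" for x y
  proof -
    have "x \<in> {a<..<b}" using that by (auto simp: piece_def)
    then show ?thesis using piece_unique[OF g that \<xi>] by blast
  qed
  have "isCont \<xi> x" if x: "x \<in> {a<..<b}" for x
    unfolding isCont_def
  proof (rule tendstoI)
    fix \<epsilon> :: real assume "\<epsilon> > 0"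
    have "eventually (\<lambda>x'. dist (\<xi> x') (\<xi> x) < \<epsilon>) (nhds x)"
      using piece_near[OF g \<xi>[OF x] \<open>\<epsilon> > 0\<close>] by (rule eventually_mono) (auto dest: un)
    then show "eventually (\<lambda>x'. dist (\<xi> x') (\<xi> x) < \<epsilon>) (at x)"
      using eventually_nhds_conv_at by blast
  qed
  then have "continuous_on {a<..<b} \<xi>" by (simp add: continuous_at_imp_continuous_on)
  moreover have "piece a b l = (\<lambda>x. (x, \<xi> x)) ` {a<..<b}"
  proof (intro equalityI subsetI)
    fix p assume p: "p \<in> piece a b l"
    then have "fst p \<in> {a<..<b}" "snd p = \<xi> (fst p)" using un[of "fst p" "snd p"] by (auto simp: piece_def)
    then show "p \<in> (\<lambda>x. (x, \<xi> x)) ` {a<..<b}"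
      by (intro image_eqI[of _ _ "fst p"] prod_eqI) simp_all
  qed (use \<xi> in auto)
  ultimately show ?thesis using that by blast
qed

text \<open>The values added at \<open>a\<close> and \<open>b\<close> keep the graph in
  \<open>X\<close>, so the arc will end in points of \<open>X\<close> over exceptional abscissae,
  that is, in vertices.\<close>

lemma piece_closed_graph:
  assumes g: "gap a b" and ne: "piece a b l \<noteq> {}"
  obtains \<eta> where "continuous_on {a..b} \<eta>" "\<And>x. x \<in> {a..b} \<Longrightarrow> (x, \<eta> x) \<in> X"
    "piece a b l = (\<lambda>x. (x, \<eta> x)) ` {a<..<b}"
proof -
  obtain \<xi> where \<xi>: "continuous_on {a<..<b} \<xi>" and gr: "piece a b l = (\<lambda>x. (x, \<xi> x)) ` {a<..<b}"
    by (rule piece_graph[OF g ne])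
  have ab: "a < b" using g by (simp add: gap_def)
  have inX: "(x, \<xi> x) \<in> X" if "x \<in> {a<..<b}" for x
    using gr that by (auto simp: piece_def)
  have bd: "bounded (\<xi> ` {a<..<b})"
  proof -
    have "\<xi> ` {a<..<b} \<subseteq> snd ` (X \<inter> {a..b} \<times> UNIV)" using inX by force
    then show ?thesis using bounded_snd[OF bounded_strip] bounded_subset by blast
  qed
  \<comment> \<open>A cluster value at \<open>e\<close> is the ordinate of a point of the closed set
    \<open>X\<close>, hence one of the finitely many in the fibre over \<open>e\<close>.\<close>
  have ends: "\<exists>l. (e, l) \<in> X \<and> (\<xi> \<longlongrightarrow> l) (at e within {a<..<b})" if e: "e \<in> {a..b}" for e
  proof -
    have "c \<in> {y. (e, y) \<in> X}"
      if x: "\<And>n. x n \<in> {a<..<b}" "x \<longlonglongrightarrow> e" and c: "(\<lambda>n. \<xi> (x n)) \<longlonglongrightarrow> c" for x :: "nat \<Rightarrow> real" and c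
    proof -
      have "(\<lambda>n. (x n, \<xi> (x n))) \<longlonglongrightarrow> (e, c)" using x(2) c by (rule tendsto_Pair)
      from closed_sequentially[OF closed_X _ this] show ?thesis using inX[OF x(1)] by simp
    qed
    moreover have "e \<in> closure {a<..<b}" using e ab by (simp add: closure_greaterThanLessThan)
    ultimately obtain l where "l \<in> {y. (e, y) \<in> X}" "(\<xi> \<longlongrightarrow> l) (at e within {a<..<b})"
      using tendsto_if_finite_cluster_values[OF _ _ \<xi> bd finite_fibre, of e e] by auto
    then show ?thesis by blast
  qed
  obtain la where la: "(a, la) \<in> X" "(\<xi> \<longlongrightarrow> la) (at a within {a<..<b})" using ends[of a] ab by auto
  obtain lb where lb: "(b, lb) \<in> X" "(\<xi> \<longlongrightarrow> lb) (at b within {a<..<b})" using ends[of b] ab by auto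
  define \<eta> where "\<eta> x = (if x \<le> a then la else if x \<ge> b then lb else \<xi> x)" for x
  have eq: "\<eta> x = \<xi> x" if "x \<in> {a<..<b}" for x using that by (auto simp: \<eta>_def)
  have "continuous_on {a..b} \<eta>"
  proof (rule continuous_on_IccI[OF _ _ _ ab])
    have "(\<eta> \<longlongrightarrow> la) (at a within {a<..<b})"
      using la(2) by (rule Lim_transform_within[OF _ zero_less_one]) (simp add: eq)
    moreover have "at a within {a<..<b} = at_right a"
      using ab by (intro at_within_nhd[of _ "{..<b}"]) auto
    ultimately show "(\<eta> \<longlongrightarrow> \<eta> a) (at_right a)" by (simp add: \<eta>_def)
    have "(\<eta> \<longlongrightarrow> lb) (at b within {a<..<b})"
      using lb(2) by (rule Lim_transform_within[OF _ zero_less_one]) (simp add: eq)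
    moreover have "at b within {a<..<b} = at_left b"
      using ab by (intro at_within_nhd[of _ "{a<..}"]) auto
    moreover have "\<eta> b = lb" using ab by (simp add: \<eta>_def)
    ultimately show "(\<eta> \<longlongrightarrow> \<eta> b) (at_left b)" by metis
    fix x assume x: "a < x" "x < b"
    have "isCont \<xi> x" using \<xi> x by (simp add: continuous_on_eq_continuous_at)
    then have "\<xi> \<midarrow>x\<rightarrow> \<eta> x" using x by (simp add: isCont_def eq)
    then show "\<eta> \<midarrow>x\<rightarrow> \<eta> x"
      by (rule Lim_transform_within_open[of _ _ _ _ "{a<..<b}"]) (use x eq in auto)
  qed
  moreover have "(x, \<eta> x) \<in> X" if "x \<in> {a..b}" for x
    using that la lb inX[of x] by (auto simp: \<eta>_def)
  moreover have "piece a b l = (\<lambda>x. (x, \<eta> x)) ` {a<..<b}" unfolding gr using eq by auto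
  ultimately show ?thesis using that by blast
qed

lemma piece_arc:
  assumes g: "gap a b" and ne: "piece a b l \<noteq> {}"
  obtains \<Phi> where "cell_arc {p \<in> X. fst p \<in> C} (piece a b l) \<Phi>"
proof -
  obtain \<eta> where \<eta>: "continuous_on {a..b} \<eta>" "\<And>x. x \<in> {a..b} \<Longrightarrow> (x, \<eta> x) \<in> X"
    and gr: "piece a b l = (\<lambda>x. (x, \<eta> x)) ` {a<..<b}"
    using piece_closed_graph[OF g ne] by blast
  have ab: "a < b" "a \<in> C" "b \<in> C" using g by (auto simp: gap_def)
  \<comment> \<open>Midpoint and half-length: t goes to \<open>m + t * h\<close> maps [-1, 1]
    affinely onto [a, b].\<close>
  define m h where "m = (a + b) / 2" and "h = (b - a) / 2"
  have h: "h > 0" "m - h = a" "m + h = b" using ab by (simp_all add: m_def h_def field_simps)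
  define x where "x t = m + t * h" for t
  have x_ends: "x (-1) = a" "x 1 = b" using h by (simp_all add: x_def)
  have x_less: "x s < x t" if "s < t" for s t using that h by (simp add: x_def)
  then have x_le: "x s \<le> x t" if "s \<le> t" for s t using that by (metis order_le_less)
  have xI: "x t \<in> {a..b}" if "t \<in> {-1..1}" for t
    using x_le[of "-1" t] x_le[of t 1] that x_ends by auto
  have xI': "x t \<in> {a<..<b}" if "t \<in> {-1<..<1}" for t
    using x_less[of "-1" t] x_less[of t 1] that x_ends by auto
  have cx: "continuous_on S x" for S unfolding x_def by (intro continuous_intros)
  define \<Phi> where "\<Phi> t = (x t, \<eta> (x t))" for t
  define \<Psi> where "\<Psi> p = (fst p - m) / h" for p :: "real \<times> real"
  have c\<Phi>: "continuous_on {-1..1} \<Phi>"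
    unfolding \<Phi>_def by (intro continuous_on_Pair cx continuous_on_compose2[OF \<eta>(1)]) (use xI in auto)
  have inv: "\<Psi> (\<Phi> t) = t" for t using h(1) by (simp add: \<Psi>_def \<Phi>_def x_def)
  have xinv: "x (\<Psi> p) = fst p" for p using h(1) by (simp add: \<Psi>_def x_def)
  have im: "\<Phi> ` {-1<..<1} = piece a b l"
  proof (intro equalityI subsetI)
    fix p assume "p \<in> piece a b l"
    then obtain u where u: "u \<in> {a<..<b}" "p = (u, \<eta> u)" unfolding gr by blast
    have "\<Phi> (\<Psi> p) = p" unfolding \<Phi>_def xinv using u by simp
    moreover have "\<not> \<Psi> p \<le> -1" "\<not> 1 \<le> \<Psi> p"
      using x_le[of "\<Psi> p" "-1"] x_le[of 1 "\<Psi> p"] x_ends xinv[of p] u by auto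
    moreover have "\<Psi> p \<in> {-1<..<1}" using calculation by simp
    ultimately show "p \<in> \<Phi> ` {-1<..<1}" by (metis imageI)
  qed (use xI' in \<open>auto simp: gr \<Phi>_def\<close>)
  have "homeomorphism {-1<..<1} (piece a b l) \<Phi> \<Psi>"
  proof (rule homeomorphismI)
    show "continuous_on {-1<..<1} \<Phi>" by (rule continuous_on_subset[OF c\<Phi>]) auto
    show "continuous_on (piece a b l) \<Psi>" unfolding \<Psi>_def using h(1) by (intro continuous_intros) auto
    show "\<Psi> ` piece a b l \<subseteq> {-1<..<1}" unfolding im[symmetric] using inv by auto
    show "\<Phi> (\<Psi> p) = p" if "p \<in> piece a b l" for p
      using that unfolding im[symmetric] using inv by auto
  qed (use im inv in auto)
  moreover have "\<Phi> (-1) \<in> {p \<in> X. fst p \<in> C}" "\<Phi> 1 \<in> {p \<in> X. fst p \<in> C}"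
    using \<eta>(2)[of a] \<eta>(2)[of b] ab by (simp_all add: \<Phi>_def x_ends)
  ultimately have "cell_arc {p \<in> X. fst p \<in> C} (piece a b l) \<Phi>"
    using c\<Phi> unfolding cell_arc_def by blast
  then show ?thesis using that by blast
qed

section \<open>The cells of a branched curve\<close>

definition vertices :: "(real \<times> real) set set" where
  "vertices = {{p} | p. p \<in> X \<and> fst p \<in> C}"

text \<open>Taking the label from a point over the gap excludes empty pieces.\<close>

definition edges :: "(real \<times> real) set set" where
  "edges = {piece a b (L p) | a b p. gap a b \<and> p \<in> X \<and> a < fst p \<and> fst p < b}"

lemma edge_projection_not_C: "e \<in> edges \<Longrightarrow> p \<in> e \<Longrightarrow> p \<in> X \<and> fst p \<notin> C"
  using gap_not_C unfolding edges_def piece_def by blast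

lemma finite_vertices_bounded: "finite {e \<in> vertices. e \<inter> cball 0 r \<noteq> {}}"
proof (rule finite_subset)
  show "{e \<in> vertices. e \<inter> cball 0 r \<noteq> {}} \<subseteq>
    (\<lambda>p. {p}) ` (SIGMA x:C \<inter> {-r..r}. {y. (x, y) \<in> X})"
  proof
    fix e assume "e \<in> {e \<in> vertices. e \<inter> cball 0 r \<noteq> {}}"
    then obtain p where p: "e = {p}" "p \<in> X" "fst p \<in> C" "norm p \<le> r" by (auto simp: vertices_def)
    then have "\<bar>fst p\<bar> \<le> r" using norm_fst_le[of "fst p" "snd p"] by simp
    then have "(fst p, snd p) \<in> (SIGMA x:C \<inter> {-r..r}. {y. (x, y) \<in> X})"
      using p(2,3) by (intro SigmaI) auto
    then show "e \<in> (\<lambda>p. {p}) ` (SIGMA x:C \<inter> {-r..r}. {y. (x, y) \<in> X})"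
      using p(1) by simp
  qed
  show "finite ((\<lambda>p. {p}) ` (SIGMA x:C \<inter> {-r..r}. {y. (x, y) \<in> X}))"
    by (intro finite_imageI finite_SigmaI finite_C finite_fibre)
qed

text \<open>An edge is determined by its gap and its point over the midpoint of the gap. Finitely
  many gaps matter, and each midpoint has a finite fibre.\<close>

lemma finite_edges_bounded: "finite {e \<in> edges. e \<inter> cball 0 r \<noteq> {}}"
proof (rule finite_subset)
  \<comment> \<open>Gaps have length at most 1, so the ends of one that meets [-r, r] lie in
    [-r-1, r+1].\<close>
  let ?D = "C \<inter> {-r-1..r+1}"
  let ?E = "\<lambda>(a, b). (\<lambda>y. piece a b (L ((a + b) / 2, y))) ` {y. ((a + b) / 2, y) \<in> X}"
  show "{e \<in> edges. e \<inter> cball 0 r \<noteq> {}} \<subseteq> (\<Union>ab \<in> ?D \<times> ?D. ?E ab)"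
  proof
    fix e assume "e \<in> {e \<in> edges. e \<inter> cball 0 r \<noteq> {}}"
    then have "e \<in> edges" "e \<inter> cball 0 r \<noteq> {}" by simp_all
    then obtain a b p where e: "e = piece a b (L p)" "gap a b" "p \<in> X" "a < fst p" "fst p < b"
      unfolding edges_def by blast
    obtain q where q: "q \<in> e" "norm q \<le> r" using \<open>e \<inter> cball 0 r \<noteq> {}\<close> by force
    have "\<bar>fst q\<bar> \<le> r" using norm_fst_le[of "fst q" "snd q"] q by simp
    moreover have "a < fst q" "fst q < b" using q e by (auto simp: piece_def)
    moreover have "b \<le> a + 1" using gap_length[OF e(2)] .
    ultimately have D: "(a, b) \<in> ?D \<times> ?D" using e(2) by (auto simp: gap_def)
    have "p \<in> piece a b (L p)" using e by (simp add: piece_def)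
    then have "piece a b (L p) \<noteq> {}" by blast
    then have "(a + b) / 2 \<in> fst ` piece a b (L p)"
      using piece_projection[OF e(2)] e(2) by (auto simp: gap_def field_simps)
    then obtain y where "((a + b) / 2, y) \<in> piece a b (L p)" by auto
    then have "((a + b) / 2, y) \<in> X" "L ((a + b) / 2, y) = L p" by (simp_all add: piece_def)
    then have "e \<in> ?E (a, b)" using e(1) by (auto intro!: image_eqI[of _ _ y])
    then show "e \<in> (\<Union>ab \<in> ?D \<times> ?D. ?E ab)" using D by blast
  qed
  show "finite (\<Union>ab \<in> ?D \<times> ?D. ?E ab)"
    by (intro finite_UN_I finite_cartesian_product finite_C) (auto intro: finite_fibre)
qed

lemma semialg_edge:
  assumes "e \<in> edges"
  shows "semialg e"
proof -
  obtain a b p where e: "e = piece a b (L p)" "p \<in> X" using assms unfolding edges_def by blast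
  have "e = {q \<in> X. L q = L p} \<inter> ({q. fst q > a} \<inter> {q. fst q < b})"
    unfolding e piece_def by auto
  then show ?thesis
    by (simp only:) (intro semialg_Int label_semialg semialg_halfplanes e(2))
qed

lemma graph_decomposition_vertices_edges: "graph_decomposition X (vertices \<union> edges)"
proof -
  have V: "{p. {p} \<in> vertices \<union> edges} \<supseteq> {p \<in> X. fst p \<in> C}" unfolding vertices_def by blast
  have ne: "{} \<notin> vertices \<union> edges"
  proof -
    have "\<exists>p. p \<in> e" if e: "e \<in> edges" for e
    proof -
      obtain a b p where "e = piece a b (L p)" "p \<in> X" "a < fst p" "fst p < b"
        using e unfolding edges_def by blast
      then have "p \<in> e" by (simp add: piece_def)
      then show ?thesis ..
    qed
    then have "{} \<notin> edges" by blast
    moreover have "{} \<notin> vertices" unfolding vertices_def by simp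
    ultimately show ?thesis by simp
  qed
  have un: "\<Union>(vertices \<union> edges) = X"
  proof (intro equalityI subsetI)
    fix p assume p: "p \<in> X"
    show "p \<in> \<Union>(vertices \<union> edges)"
    proof (cases "fst p \<in> C")
      case True
      then have "{p} \<in> vertices" using p unfolding vertices_def by blast
      then show ?thesis by blast
    next
      case False
      then obtain a b where "gap a b" "a < fst p" "fst p < b" by (rule gap_exists)
      then have "piece a b (L p) \<in> edges" using p unfolding edges_def by blast
      moreover have "p \<in> piece a b (L p)" using p \<open>a < fst p\<close> \<open>fst p < b\<close> by (simp add: piece_def)
      ultimately show ?thesis by blast
    qed
  next
    fix p assume "p \<in> \<Union>(vertices \<union> edges)"
    then show "p \<in> X" using edge_projection_not_C unfolding vertices_def by blast
  qed
  have dis: "disjoint (vertices \<union> edges)"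
    unfolding disjoint_def
  proof (intro ballI impI)
    fix e e' assume ee: "e \<in> vertices \<union> edges" "e' \<in> vertices \<union> edges" "e \<noteq> e'"
    show "e \<inter> e' = {}"
    proof (rule ccontr)
      assume "e \<inter> e' \<noteq> {}"
      then obtain p where p: "p \<in> e" "p \<in> e'" by blast
      show False
      proof (cases "fst p \<in> C")
        case True
        then have "e \<in> vertices" "e' \<in> vertices" using ee p edge_projection_not_C by blast+
        then show False using ee p unfolding vertices_def by blast
      next
        case False
        then have "e \<in> edges" "e' \<in> edges" using ee p unfolding vertices_def by blast+
        \<comment> \<open>A common point lies over one gap only and has one label; the two determine
          the edge.\<close>
        then obtain a b q a' b' q' where e: "e = piece a b (L q)" "gap a b" "e' = piece a' b' (L q')" "gap a' b'"
          unfolding edges_def by blast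
        have "a < fst p" "fst p < b" "a' < fst p" "fst p < b'" "L p = L q" "L p = L q'"
          using p e by (auto simp: piece_def)
        then show False using gap_unique[OF e(2,4)] e ee by metis
      qed
    qed
  qed
  have lf: "locally_finite_cells (vertices \<union> edges)"
    unfolding locally_finite_cells_def
  proof
    fix r
    have "{e \<in> vertices \<union> edges. e \<inter> cball 0 r \<noteq> {}} =
      {e \<in> vertices. e \<inter> cball 0 r \<noteq> {}} \<union> {e \<in> edges. e \<inter> cball 0 r \<noteq> {}}" by blast
    then show "finite {e \<in> vertices \<union> edges. e \<inter> cball 0 r \<noteq> {}}"
      using finite_vertices_bounded finite_edges_bounded by simp
  qed
  have cells: "\<forall>e\<in>vertices \<union> edges. semialg e \<and>
     ((\<exists>p. e = {p}) \<or> (\<exists>\<Phi>. cell_arc {p. {p} \<in> vertices \<union> edges} e \<Phi>))"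
  proof
    fix e assume "e \<in> vertices \<union> edges"
    then show "semialg e \<and> ((\<exists>p. e = {p}) \<or> (\<exists>\<Phi>. cell_arc {p. {p} \<in> vertices \<union> edges} e \<Phi>))"
    proof
      assume "e \<in> vertices"
      then obtain p where "e = {p}" unfolding vertices_def by blast
      then show ?thesis using semialg_sing by metis
    next
      assume e: "e \<in> edges"
      then obtain a b p where p: "e = piece a b (L p)" "gap a b" "p \<in> X" "a < fst p" "fst p < b"
        unfolding edges_def by blast
      then have "p \<in> piece a b (L p)" by (simp add: piece_def)
      then have "piece a b (L p) \<noteq> {}" by blast
      then obtain \<Phi> where "cell_arc {p \<in> X. fst p \<in> C} e \<Phi>" using piece_arc[OF p(2)] p(1) by metis
      then have "cell_arc {p. {p} \<in> vertices \<union> edges} e \<Phi>" using V unfolding cell_arc_def by blast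
      then show ?thesis using semialg_edge[OF e] by blast
    qed
  qed
  show ?thesis unfolding graph_decomposition_def
    by (intro conjI closed_X un ne dis lf cells)
qed

end

subsection \<open>Plane algebraic curves\<close>

lemma degree_higher_pderiv:
  fixes p :: "'a::{comm_semiring_1,semiring_no_zero_divisors,semiring_char_0} poly"
  shows "degree ((pderiv ^^ j) p) = degree p - j"
  by (induction j) (simp_all add: degree_pderiv)

lemma higher_pderiv_nonzero:
  fixes p :: "'a::{idom,semiring_char_0} poly"
  assumes "p \<noteq> 0" "j \<le> degree p"
  shows "(pderiv ^^ j) p \<noteq> 0"
  using assms(2)
proof (induction j)
  case (Suc j)
  have "degree ((pderiv ^^ j) p) \<noteq> 0" using Suc.prems by (simp add: degree_higher_pderiv)
  then show ?case by (simp add: pderiv_eq_0_iff)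
qed (use assms in simp)

lemma higher_pderiv_slice: "(pderiv ^^ j) (slice P x) = slice ((pderiv ^^ j) P) x"
  by (induction j) (simp_all add: pderiv_slice)

lemma ev_prod_mset_zero: "ev (prod_mset M) x y = 0 \<longleftrightarrow> (\<exists>P\<in>#M. ev P x y = 0)"
  by (induction M) auto

text \<open>The product of the prime factors recovers \<open>F\<close> only up to a unit, but
  associated polynomials divide each other and so have the same zeros.\<close>

lemma ev_zero_iff_prime_factor:
  assumes "F \<noteq> 0"
  shows "ev F x y = 0 \<longleftrightarrow> (\<exists>G\<in>prime_factors F. ev G x y = 0)"
proof -
  have "F dvd normalize F" "normalize F dvd F" by simp_all
  then have "ev F x y = 0 \<longleftrightarrow> ev (normalize F) x y = 0" using ev_dvd_zero by blast
  also have "normalize F = normalize (prod_mset (prime_factorization F))"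
    using prod_mset_prime_factorization_weak[OF assms] by simp
  also have "ev \<dots> x y = 0 \<longleftrightarrow> ev (prod_mset (prime_factorization F)) x y = 0"
    using ev_dvd_zero[of "normalize (prod_mset (prime_factorization F))" "prod_mset (prime_factorization F)" x y]
      ev_dvd_zero[of "prod_mset (prime_factorization F)" "normalize (prod_mset (prime_factorization F))" x y]
    by auto
  finally show ?thesis by (simp add: ev_prod_mset_zero)
qed

text \<open>A factor in x alone would divide every coefficient of \<open>F\<close>, in particular
  the constant leading one, and would be a unit.\<close>

lemma degree_prime_factor_pos:
  fixes F :: "real poly poly"
  assumes lc: "lead_coeff F = [:c:]" "c \<noteq> 0" and G: "G \<in> prime_factors F"
  shows "degree G > 0"
proof (rule ccontr)
  assume "\<not> degree G > 0"
  then obtain g where g: "G = [:g:]" by (metis degree_eq_zeroE gr0I)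
  have "G dvd F" using G by (rule in_prime_factors_imp_dvd)
  then have "g dvd coeff F (degree F)" unfolding g by (rule const_poly_dvd_coeff)
  then have "g dvd [:c:]" using lc by simp
  moreover have "[:c:] dvd 1" using lc(2) by (intro dvdI[of _ _ "[:1 / c:]"]) (simp add: one_pCons)
  ultimately have "g dvd 1" by (rule dvd_trans)
  then have "G dvd 1" unfolding g by (simp add: is_unit_const_poly_iff)
  moreover have "prime G" using G by (rule in_prime_factors_imp_prime)
  ultimately show False using not_prime_unit by blast
qed

text \<open>Opposite signs at two fixed heights persist on neighbouring vertical lines, and this is
  how a simple zero is continued sideways.\<close>

lemma simple_zero_sign_change:
  fixes p :: "real poly"
  assumes "poly p y = 0" "poly (pderiv p) y \<noteq> 0" "\<epsilon> > 0"
  obtains u v where "y - \<epsilon> < u" "u < y" "y < v" "v < y + \<epsilon>" "poly p u * poly p v < 0"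
proof -
  have D: "DERIV (poly p) y :> poly (pderiv p) y" by (rule poly_DERIV)
  show ?thesis
  proof (cases "poly (pderiv p) y > 0")
    case True
    obtain d where d: "d > 0" "\<And>h. 0 < h \<Longrightarrow> h < d \<Longrightarrow> poly p y < poly p (y + h)"
      using DERIV_pos_inc_right[OF D True] by blast
    obtain e where e: "e > 0" "\<And>h. 0 < h \<Longrightarrow> h < e \<Longrightarrow> poly p (y - h) < poly p y"
      using DERIV_pos_inc_left[OF D True] by blast
    define h where "h = min \<epsilon> (min d e) / 2"
    have h: "0 < h" "h < \<epsilon>" "h < d" "h < e" using d e assms by (auto simp: h_def)
    show ?thesis
      using that[of "y - h" "y + h"] h d(2)[of h] e(2)[of h] assms(1) by (simp add: mult_less_0_iff)
  next
    case False
    then have neg: "poly (pderiv p) y < 0" using assms by simp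
    obtain d where d: "d > 0" "\<And>h. 0 < h \<Longrightarrow> h < d \<Longrightarrow> poly p y > poly p (y + h)"
      using DERIV_neg_dec_right[OF D neg] by blast
    obtain e where e: "e > 0" "\<And>h. 0 < h \<Longrightarrow> h < e \<Longrightarrow> poly p (y - h) > poly p y"
      using DERIV_neg_dec_left[OF D neg] by blast
    define h where "h = min \<epsilon> (min d e) / 2"
    have h: "0 < h" "h < \<epsilon>" "h < d" "h < e" using d e assms by (auto simp: h_def)
    show ?thesis
      using that[of "y - h" "y + h"] h d(2)[of h] e(2)[of h] assms(1) by (simp add: mult_less_0_iff)
  qed
qed

lemma open_ev_pos: "open {q. ev H (fst q) (snd q) > 0}"
  and open_ev_neg: "open {q. ev H (fst q) (snd q) < 0}"
  by (intro open_Collect_less continuous_ev continuous_on_const)+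

lemma eventually_sgn_ev:
  assumes "ev H (fst p) (snd p) \<noteq> 0"
  shows "eventually (\<lambda>q. sgn (ev H (fst q) (snd q)) = sgn (ev H (fst p) (snd p))) (nhds p)"
proof (cases "ev H (fst p) (snd p) > 0")
  case True
  then have "eventually (\<lambda>q. q \<in> {q. ev H (fst q) (snd q) > 0}) (nhds p)"
    by (intro eventually_nhds_in_open open_ev_pos) simp
  then show ?thesis using True by (auto elim!: eventually_mono)
next
  case False
  then have "eventually (\<lambda>q. q \<in> {q. ev H (fst q) (snd q) < 0}) (nhds p)"
    using assms by (intro eventually_nhds_in_open open_ev_neg) simp
  then show ?thesis using False assms by (auto elim!: eventually_mono)
qed

lemma graph_decomposition_monic:
  assumes lc: "lead_coeff F = [:c:]" "c \<noteq> 0"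
  shows "\<exists>\<A>. graph_decomposition {p. ev F (fst p) (snd p) = 0} \<A>"
proof -
  define X where "X = {p. ev F (fst p) (snd p) = 0}"
  have F0: "F \<noteq> 0" using lc by auto
  define \<G> where "\<G> = prime_factors F"
  \<comment> \<open>Both extreme orders matter: order 0 records which factors vanish, and order
    \<open>degree G\<close> gives the polynomial in x at which the induction of Thom's lemma
    ends.\<close>
  define \<H> where "\<H> = (\<lambda>(G, j). (pderiv ^^ j) G) ` (SIGMA G:\<G>. {..degree G})"
  have fG: "finite \<G>" unfolding \<G>_def by simp
  have fH: "finite \<H>" unfolding \<H>_def using fG by (intro finite_imageI finite_SigmaI) auto
  have X_iff: "p \<in> X \<longleftrightarrow> (\<exists>G\<in>\<G>. ev G (fst p) (snd p) = 0)" for p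
    unfolding X_def \<G>_def using ev_zero_iff_prime_factor[OF F0] by simp
  have prime: "prime_elem G" "prime G" "degree G > 0" "G \<noteq> 0" if "G \<in> \<G>" for G
  proof -
    show "prime G" using that unfolding \<G>_def by (rule in_prime_factors_imp_prime)
    then show "prime_elem G" "G \<noteq> 0" by auto
    show "degree G > 0" using degree_prime_factor_pos[OF lc] that unfolding \<G>_def by blast
  qed
  have der: "(pderiv ^^ j) G \<in> \<H>" if "G \<in> \<G>" "j \<le> degree G" for G j
    unfolding \<H>_def using that by (intro image_eqI[of _ _ "(G, j)"]) auto
  have GH: "G \<in> \<H>" if "G \<in> \<G>" for G using der[OF that, of 0] by simp
  have ndvd: "\<not> G dvd (pderiv ^^ j) G" if "G \<in> \<G>" "0 < j" "j \<le> degree G" for G j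
  proof
    assume "G dvd (pderiv ^^ j) G"
    then have "degree G \<le> degree ((pderiv ^^ j) G)"
      using higher_pderiv_nonzero[OF prime(4)[OF that(1)] that(3)] by (rule dvd_imp_degree_le)
    then show False using that by (simp add: degree_higher_pderiv)
  qed
  \<comment> \<open>Each set is finite by \<open>finite_common_zeros\<close>. Members of
    \<open>\<H>\<close> divisible by \<open>G\<close> are left out since they vanish wherever
    \<open>G\<close> does.\<close>
  define B where "B = (\<Union>G\<in>\<G>. \<Union>H\<in>{H\<in>\<H>. \<not> G dvd H}. {x. \<exists>y. ev G x y = 0 \<and> ev H x y = 0})"
  have fB: "finite B"
    unfolding B_def using fG fH prime by (intro finite_UN_I finite_common_zeros) auto
  define C where "C = B \<union> \<int>"
  have key: "G dvd H \<or> ev H (fst p) (snd p) \<noteq> 0"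
    if "G \<in> \<G>" "H \<in> \<H>" "fst p \<notin> C" "ev G (fst p) (snd p) = 0" for G H p
    using that unfolding C_def B_def by blast
  have keyd: "ev ((pderiv ^^ j) G) (fst p) (snd p) \<noteq> 0"
    if "G \<in> \<G>" "0 < j" "j \<le> degree G" "fst p \<notin> C" "ev G (fst p) (snd p) = 0" for G j p
    using key[OF that(1) der[OF that(1,3)] that(4,5)] ndvd[OF that(1-3)] by blast
  \<comment> \<open>The default 0 outside \<open>\<H>\<close> turns equality of labels, as
    functions, into equality of signs on \<open>\<H>\<close>.\<close>
  define L where "L p = (\<lambda>H. if H \<in> \<H> then sgn (ev H (fst p) (snd p)) else 0)" for p
  have L_eq: "L p = L q \<longleftrightarrow> (\<forall>H\<in>\<H>. sgn (ev H (fst p) (snd p)) = sgn (ev H (fst q) (snd q)))" for p q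
    unfolding L_def fun_eq_iff by auto
  interpret branched_curve X C L
  proof
    show "closed X" unfolding X_def by (intro closed_Collect_eq continuous_ev continuous_on_const)
    show "bounded (X \<inter> {a..b} \<times> UNIV)" for a b
    proof -
      obtain M where M: "\<And>x y. a \<le> x \<Longrightarrow> x \<le> b \<Longrightarrow> ev F x y = 0 \<Longrightarrow> \<bar>y\<bar> \<le> M"
        using bounded_zeros[OF lc, of a b] by blast
      have "X \<inter> {a..b} \<times> UNIV \<subseteq> {a..b} \<times> {-M..M}" using M by (fastforce simp: X_def abs_le_iff)
      moreover have "bounded ({a..b} \<times> {-M..M})" by (intro bounded_Times) auto
      ultimately show ?thesis by (rule bounded_subset[rotated])
    qed
    show "finite {y. (x, y) \<in> X}" for x using finite_slice_zeros[OF lc] by (simp add: X_def)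
    show "\<int> \<subseteq> C" by (simp add: C_def)
    show "finite (C \<inter> {a..b})" for a b
    proof -
      have "\<int> \<inter> {a..b} \<subseteq> real_of_int ` {\<lfloor>a\<rfloor>..\<lceil>b\<rceil>}"
      proof
        fix x assume "x \<in> \<int> \<inter> {a..b}"
        then obtain n where "x = real_of_int n" "a \<le> x" "x \<le> b" by (auto elim: Ints_cases)
        then have "n \<in> {\<lfloor>a\<rfloor>..\<lceil>b\<rceil>}" by (auto; linarith)
        then show "x \<in> real_of_int ` {\<lfloor>a\<rfloor>..\<lceil>b\<rceil>}" using \<open>x = real_of_int n\<close> by blast
      qed
      then have "finite (\<int> \<inter> {a..b})" by (rule finite_subset) simp
      then show ?thesis using fB by (simp add: C_def Int_Un_distrib2)
    qed
    show "eventually (\<lambda>q. q \<in> X \<longrightarrow> L q = L p) (nhds p)" if p: "p \<in> X" "fst p \<notin> C" for p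
    proof -
      obtain G where G: "G \<in> \<G>" "ev G (fst p) (snd p) = 0" using p X_iff by blast
      have "eventually (\<lambda>q. \<forall>H\<in>{H\<in>\<H>. \<not> G dvd H}. sgn (ev H (fst q) (snd q)) = sgn (ev H (fst p) (snd p))) (nhds p)"
      proof (rule eventually_ball_finite)
        show "finite {H\<in>\<H>. \<not> G dvd H}" using fH by simp
        show "\<forall>H\<in>{H\<in>\<H>. \<not> G dvd H}. eventually (\<lambda>q. sgn (ev H (fst q) (snd q)) = sgn (ev H (fst p) (snd p))) (nhds p)"
        proof
          fix H assume "H \<in> {H\<in>\<H>. \<not> G dvd H}"
          then have "ev H (fst p) (snd p) \<noteq> 0" using key[OF G(1) _ p(2) G(2)] by blast
          then show "eventually (\<lambda>q. sgn (ev H (fst q) (snd q)) = sgn (ev H (fst p) (snd p))) (nhds p)"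
            by (rule eventually_sgn_ev)
        qed
      qed
      then show ?thesis
      proof (rule eventually_mono, intro impI)
        fix q assume sgn: "\<forall>H\<in>{H\<in>\<H>. \<not> G dvd H}. sgn (ev H (fst q) (snd q)) = sgn (ev H (fst p) (snd p))"
          and q: "q \<in> X"
        obtain G' where G': "G' \<in> \<G>" "ev G' (fst q) (snd q) = 0" using q X_iff by blast
        \<comment> \<open>Otherwise \<open>G'\<close>, itself in \<open>\<H>\<close>, would be
          nonzero at \<open>p\<close> and keep its sign as far as \<open>q\<close>, where it
          vanishes.\<close>
        have "G dvd G'"
        proof (rule ccontr)
          assume n: "\<not> G dvd G'"
          then have "sgn (ev G' (fst p) (snd p)) = 0" using sgn GH[OF G'(1)] G'(2) by force
          then have "ev G' (fst p) (snd p) = 0" by (simp add: sgn_zero_iff)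
          then show False using key[OF G(1) GH[OF G'(1)] p(2) G(2)] n by blast
        qed
        \<comment> \<open>\<open>prime\<close> includes normalization, so one prime dividing another
          gives equality and not mere association.\<close>
        then have "G = G'" by (rule primes_dvd_imp_eq[OF prime(2)[OF G(1)] prime(2)[OF G'(1)]])
        then have Gq: "ev G (fst q) (snd q) = 0" using G' by simp
        show "L q = L p"
          unfolding L_eq
        proof
          fix H assume H: "H \<in> \<H>"
          show "sgn (ev H (fst q) (snd q)) = sgn (ev H (fst p) (snd p))"
          proof (cases "G dvd H")
            case True
            then show ?thesis using ev_dvd_zero Gq G(2) by metis
          next
            case False
            then show ?thesis using sgn H by blast
          qed
        qed
      qed
    qed
    show "y = y'" if xy: "(x, y) \<in> X" "(x, y') \<in> X" "x \<notin> C" "L (x, y) = L (x, y')" for x y y'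
    proof -
      obtain G where G: "G \<in> \<G>" "ev G x y = 0" using xy X_iff[of "(x, y)"] by auto
      have sg: "sgn (ev ((pderiv ^^ j) G) x y) = sgn (ev ((pderiv ^^ j) G) x y')" if "j \<le> degree G" for j
        using xy(4) der[OF G(1) that] unfolding L_eq by auto
      have G': "ev G x y' = 0" using sg[of 0] G(2) by (simp add: sgn_zero_iff)
      \<comment> \<open>\<open>thom_unique_zero\<close> wants its zeros in order; stating the claim
        for \<open>u\<close> and \<open>v\<close> serves both orders of \<open>y\<close> and
        \<open>y'\<close>.\<close>
      have eq: "u = v" if "u \<le> v" and uv: "(u, v) = (y, y') \<or> (u, v) = (y', y)" for u v
      proof (rule thom_unique_zero[of "degree G" "slice G x"])
        fix j assume j: "0 < j" "j \<le> degree G"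
        show "sgn (poly ((pderiv ^^ j) (slice G x)) u) = sgn (poly ((pderiv ^^ j) (slice G x)) v)"
          unfolding higher_pderiv_slice poly_slice using sg[OF j(2)] uv by auto
        have "ev ((pderiv ^^ j) G) x y \<noteq> 0" "ev ((pderiv ^^ j) G) x y' \<noteq> 0"
          using keyd[OF G(1) j, of "(x, y)"] keyd[OF G(1) j, of "(x, y')"] xy(3) G(2) G' by simp_all
        then show "poly ((pderiv ^^ j) (slice G x)) u \<noteq> 0"
          unfolding higher_pderiv_slice poly_slice using uv by auto
      qed (use that G G' prime(3)[OF G(1)] in \<open>auto simp: poly_slice degree_slice_le\<close>)
      show ?thesis
      proof (cases "y \<le> y'")
        case True
        then show ?thesis by (rule eq) simp
      next
        case False
        then have "y' = y" by (intro eq) simp_all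
        then show ?thesis ..
      qed
    qed
    show "eventually (\<lambda>x'. \<exists>y'. (x', y') \<in> X \<and> dist y' y < \<epsilon>) (nhds x)"
      if xy: "(x, y) \<in> X" "x \<notin> C" "\<epsilon> > 0" for x y \<epsilon>
    proof -
      obtain G where G: "G \<in> \<G>" "ev G x y = 0" using xy X_iff[of "(x, y)"] by auto
      have "poly (slice G x) y = 0" using G by (simp add: poly_slice)
      moreover have "poly (pderiv (slice G x)) y \<noteq> 0"
        using keyd[OF G(1), of 1 "(x, y)"] prime(3)[OF G(1)] xy G by (simp add: pderiv_slice poly_slice)
      ultimately obtain u v where uv: "y - \<epsilon> < u" "u < y" "y < v" "v < y + \<epsilon>"
        "poly (slice G x) u * poly (slice G x) v < 0"
        using simple_zero_sign_change[of "slice G x" y \<epsilon>] xy(3) by blast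
      have "continuous_on UNIV (\<lambda>x. ev G x w)" for w
        using continuous_on_compose2[OF continuous_ev[of G], of UNIV "\<lambda>x. (x, w)"]
        by (simp add: continuous_on_Pair)
      \<comment> \<open>The heights \<open>u\<close> and \<open>v\<close> stay fixed, so the sign
        change is an open condition on the abscissa.\<close>
      then have "open {x'. ev G x' u * ev G x' v < 0}"
        by (intro open_Collect_less continuous_on_mult continuous_on_const)
      then have "eventually (\<lambda>x'. x' \<in> {x'. ev G x' u * ev G x' v < 0}) (nhds x)"
        using uv(5) by (intro eventually_nhds_in_open) (simp_all add: poly_slice)
      then show ?thesis
      proof (rule eventually_mono)
        fix x' assume "x' \<in> {x'. ev G x' u * ev G x' v < 0}"
        then have "poly (slice G x') u * poly (slice G x') v < 0" by (simp add: poly_slice)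
        then have "\<exists>z. u < z \<and> z < v \<and> poly (slice G x') z = 0"
          using poly_IVT[of u v "slice G x'"] uv by (metis less_trans)
        then obtain z where z: "u < z" "z < v" "poly (slice G x') z = 0" by blast
        then have "(x', z) \<in> X" using X_iff[of "(x', z)"] G(1) by (auto simp: poly_slice)
        moreover have "dist z y < \<epsilon>" using z uv by (simp add: dist_real_def abs_less_iff)
        ultimately show "\<exists>y'. (x', y') \<in> X \<and> dist y' y < \<epsilon>" by blast
      qed
    qed
    show "semialg {q \<in> X. L q = L p}" if "p \<in> X" for p
    proof -
      have "{q \<in> X. L q = L p} = X \<inter> (\<Inter>H\<in>\<H>. {q. sgn (ev H (fst q) (snd q)) = sgn (ev H (fst p) (snd p))})"
        unfolding L_eq by auto
      then show ?thesis
        unfolding X_def by (simp only:) (intro semialg_Int semialg_ev_eq semialg_INT fH semialg_ev_sgn)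
    qed
  qed
  show ?thesis using graph_decomposition_vertices_edges unfolding X_def by blast
qed

section \<open>Transport along the shear\<close>

lemma shear_inverse: "shear (-l) (shear l p) = p" "shear l (shear (-l) p) = p"
  by (simp_all add: shear_def)

lemma continuous_on_shear: "continuous_on S (shear l)"
  unfolding shear_def by (intro continuous_intros)

text \<open>Preimages commute with complements and with composition of polynomials, which the
  induction in \<open>semialg_shear\<close> needs.\<close>

lemma shear_image: "shear l ` S = shear (-l) -` S"
proof (intro equalityI subsetI)
  fix p assume "p \<in> shear (-l) -` S"
  then have "shear l (shear (-l) p) \<in> shear l ` S" by blast
  then show "p \<in> shear l ` S" by (simp only: shear_inverse)
qed (auto simp: shear_inverse)

lemma is_poly2_shear:
  assumes "is_poly2 f"
  shows "is_poly2 (\<lambda>p. f (shear l p))"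
proof -
  obtain c d where c: "\<And>x y. f (x, y) = (\<Sum>i\<le>(d::nat). \<Sum>j\<le>d. c i j * x ^ i * y ^ j)"
    using assms unfolding is_poly2_def by blast
  define P where "P = (\<Sum>i\<le>d. \<Sum>j\<le>d. [:[:c i j:]:] * [:[:0,1:], [:l:]:] ^ i * [:0,1:] ^ j)"
  have "f (shear l p) = ev P (fst p) (snd p)" for p
    by (simp add: shear_def c P_def ev_sum mult_ac)
  then show ?thesis using is_poly2_ev[of P] by presburger
qed

lemma semialg_shear: "semialg S \<Longrightarrow> semialg (shear l ` S)"
  unfolding shear_image
proof (induction rule: semialg.induct)
  case (zero f)
  show ?case using semialg.zero[OF is_poly2_shear[OF zero]] by (simp add: vimage_def)
next
  case (pos f)
  show ?case using semialg.pos[OF is_poly2_shear[OF pos]] by (simp add: vimage_def)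
next
  case (union S T)
  then show ?case using semialg.union by (simp add: vimage_Un)
next
  case (compl S)
  then show ?case using semialg.compl by (simp add: vimage_Compl)
qed

lemma bounded_shear:
  assumes "bounded B"
  shows "bounded (shear l ` B)"
proof -
  have "compact (shear l ` closure B)"
    using assms by (intro compact_continuous_image continuous_on_shear) (simp add: compact_closure)
  then show ?thesis
    using bounded_subset[OF compact_imp_bounded image_mono[OF closure_subset]] by blast
qed

lemma graph_decomposition_zero_set:
  assumes "ev P x0 y0 \<noteq> 0"
  shows "\<exists>\<A>. graph_decomposition {p. ev P (fst p) (snd p) = 0} \<A>"
proof -
  obtain l Q c where Q: "\<And>x y. ev Q x y = ev P (x + l * y) y" "lead_coeff Q = [:c:]" "c \<noteq> 0"
    using ev_shear_monic[OF assms] by metis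
  obtain \<A> where \<A>: "graph_decomposition {p. ev Q (fst p) (snd p) = 0} \<A>"
    using graph_decomposition_monic[OF Q(2,3)] by blast
  \<comment> \<open>\<open>Q\<close> is \<open>P\<close> composed with \<open>shear l\<close>, so
    the shear carries the zeros of \<open>Q\<close> onto those of \<open>P\<close>.\<close>
  have im: "shear l ` {p. ev Q (fst p) (snd p) = 0} = {p. ev P (fst p) (snd p) = 0}"
    unfolding shear_image Q(1) by (auto simp: shear_def)
  have hom: "homeomorphism UNIV UNIV (shear l) (shear (-l))"
    by (intro homeomorphismI continuous_on_shear) (simp_all add: shear_inverse)
  have "graph_decomposition {p. ev P (fst p) (snd p) = 0} ((`) (shear l) ` \<A>)"
    using graph_decomposition_homeomorphism_image[OF \<A> hom bounded_shear semialg_shear] unfolding im .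
  then show ?thesis by blast
qed

subsection \<open>Shortest curves in the plane\<close>

text \<open>\<open>integral\<close> has a default value on functions that are not integrable, so
  integrability of the speed accompanies the chord bound. The bound is on all subintervals so that
  pieces can be joined and then cut at any parameter.\<close>

definition rectifiable_on :: "real \<Rightarrow> real \<Rightarrow> (real \<Rightarrow> real \<times> real) \<Rightarrow> bool" where
  "rectifiable_on a b g \<longleftrightarrow> (\<lambda>t. norm (vector_derivative g (at t))) integrable_on {a..b} \<and>
     (\<forall>s t. a \<le> s \<longrightarrow> s \<le> t \<longrightarrow> t \<le> b \<longrightarrow>
       norm (g t - g s) \<le> integral {s..t} (\<lambda>t. norm (vector_derivative g (at t))))"

lemma C2_on_rectifiable:
  assumes "C2_on a b g"
  shows "rectifiable_on a b g"
proof -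
  let ?N = "\<lambda>t. norm (vector_derivative g (at t))"
  obtain g1 g2 where d: "\<And>t. t \<in> {a..b} \<Longrightarrow> (g has_vector_derivative g1 t) (at t within {a..b})"
    and d1: "\<And>t. t \<in> {a..b} \<Longrightarrow> (g1 has_vector_derivative g2 t) (at t within {a..b})"
    using assms unfolding C2_on_def by blast
  have "continuous_on {a..b} g1"
    using d1 has_vector_derivative_continuous continuous_on_eq_continuous_within by blast
  then have cont: "continuous_on {s..t} (\<lambda>t. norm (g1 t))" "continuous_on {s..t} g1"
    if "a \<le> s" "t \<le> b" for s t
    using that by (auto intro!: continuous_on_norm elim: continuous_on_subset)
  \<comment> \<open>At the ends \<open>g1\<close> is only a one-sided derivative, while
    \<open>curve_length\<close> uses the two-sided one; two points do not affect the
    integral.\<close>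
  have eq: "?N t = norm (g1 t)" if "t \<in> {a..b} - {a, b}" for t
  proof -
    have t: "t \<in> {a<..<b}" using that by auto
    then have "at t within {a..b} = at t" by (intro at_within_interior) simp
    then have "(g has_vector_derivative g1 t) (at t)" using d[of t] t by simp
    then show ?thesis by (simp add: vector_derivative_at)
  qed
  have int: "?N integrable_on {s..t}" if "a \<le> s" "t \<le> b" for s t
  proof (rule integrable_spike_finite[of "{a, b}"])
    show "(\<lambda>t. norm (g1 t)) integrable_on {s..t}"
      using cont(1)[OF that] integrable_continuous_real by blast
  qed (use eq that in auto)
  have "norm (g t - g s) \<le> integral {s..t} ?N" if st: "a \<le> s" "s \<le> t" "t \<le> b" for s t
  proof -
    have "(g1 has_integral g t - g s) {s..t}"
    proof (rule fundamental_theorem_of_calculus[OF st(2)])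
      fix x assume "x \<in> {s..t}"
      then show "(g has_vector_derivative g1 x) (at x within {s..t})"
        using st by (intro has_vector_derivative_within_subset[OF d]) auto
    qed
    then have "g t - g s = integral {s..t} g1" by (simp add: integral_unique)
    also have "norm \<dots> \<le> integral {s..t} (\<lambda>t. norm (g1 t))"
      using cont[OF st(1,3)]
      by (intro Henstock_Kurzweil_Integration.integral_norm_bound_integral integrable_continuous_real) auto
    also have "\<dots> = integral {s..t} ?N"
      by (rule integral_spike[of "{a, b}"]) (use eq st in auto)
    finally show ?thesis .
  qed
  then show ?thesis unfolding rectifiable_on_def using int by blast
qed

lemma rectifiable_on_combine:
  assumes ab: "rectifiable_on a b g" and bc: "rectifiable_on b c g" and "a \<le> b" "b \<le> c"
  shows "rectifiable_on a c g"
proof -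
  let ?N = "\<lambda>t. norm (vector_derivative g (at t))"
  have int: "?N integrable_on {a..c}"
    using Henstock_Kurzweil_Integration.integrable_combine[OF assms(3,4)] ab bc unfolding rectifiable_on_def by blast
  have "norm (g t - g s) \<le> integral {s..t} ?N" if st: "a \<le> s" "s \<le> t" "t \<le> c" for s t
  proof -
    consider "t \<le> b" | "b \<le> s" | "s \<le> b" "b \<le> t" by linarith
    then show ?thesis
    proof cases
      case 3
      have "norm (g t - g s) \<le> norm (g b - g s) + norm (g t - g b)"
        using norm_triangle_ineq[of "g b - g s" "g t - g b"] by simp
      also have "\<dots> \<le> integral {s..b} ?N + integral {b..t} ?N"
        using ab bc st 3 unfolding rectifiable_on_def by (intro add_mono) auto
      also have "\<dots> = integral {s..t} ?N"
        using st 3 by (intro Henstock_Kurzweil_Integration.integral_combine integrable_subinterval_real[OF int]) auto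
      finally show ?thesis .
    qed (use ab bc st in \<open>auto simp: rectifiable_on_def\<close>)
  qed
  then show ?thesis unfolding rectifiable_on_def using int by blast
qed

lemma rectifiable_on_refl: "rectifiable_on a a g"
  unfolding rectifiable_on_def
proof (intro conjI allI impI)
  fix s t assume "a \<le> s" "s \<le> t" "t \<le> a"
  then have "s = a" "t = a" by simp_all
  then show "norm (g t - g s) \<le> integral {s..t} (\<lambda>t. norm (vector_derivative g (at t)))" by simp
qed (metis integrable_on_refl box_real(2))

lemma rectifiable_on_pieces:
  assumes "ts \<noteq> []" "sorted_wrt (<) ts" "\<And>i. Suc i < length ts \<Longrightarrow> C2_on (ts ! i) (ts ! Suc i) g"
  shows "rectifiable_on (hd ts) (last ts) g \<and> hd ts \<le> last ts"
  using assms
proof (induction ts)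
  case (Cons x ts)
  note IH = Cons.IH and prems = Cons.prems
  show ?case
  proof (cases ts)
    case Nil
    then show ?thesis by (simp add: rectifiable_on_refl)
  next
    case ts: (Cons y zs)
    have "rectifiable_on (hd ts) (last ts) g \<and> hd ts \<le> last ts"
    proof (rule IH)
      fix i assume "Suc i < length ts"
      then show "C2_on (ts ! i) (ts ! Suc i) g" using prems(3)[of "Suc i"] by simp
    qed (use ts prems in simp_all)
    then have 1: "rectifiable_on y (last ts) g" "y \<le> last ts" using ts by simp_all
    have 2: "rectifiable_on x y g" using prems(3)[of 0] ts by (simp add: C2_on_rectifiable)
    have "x \<le> y" using prems(2) ts by simp
    then show ?thesis using rectifiable_on_combine[OF 2 1(1)] 1 ts by simp
  qed
qed simp

lemma piecewise_C2_rectifiable: "piecewise_C2 g \<Longrightarrow> rectifiable_on 0 1 g"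
  unfolding piecewise_C2_def using rectifiable_on_pieces by metis

lemma curve_in_linepath: "curve_in UNIV A B (linepath A B)"
proof -
  have "C2_on 0 1 (linepath A B)"
    unfolding C2_on_def
    by (intro exI[of _ "\<lambda>_. B - A"] exI[of _ "\<lambda>_. 0"])
       (auto intro!: has_vector_derivative_linepath_within derivative_eq_intros)
  then have "piecewise_C2 (linepath A B)"
    unfolding piecewise_C2_def by (intro conjI exI[of _ "[0, 1]"]) auto
  then show ?thesis by (simp add: curve_in_def)
qed

text \<open>The straight segment competes, so the length of \<open>g\<close> is at most
  \<open>dist A B\<close>. The chords from \<open>A\<close> to \<open>p\<close> and from
  \<open>p\<close> to \<open>B\<close> are no longer than the two parts of \<open>g\<close>, and
  equality in the triangle inequality puts \<open>p\<close> between \<open>A\<close> and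
  \<open>B\<close>.\<close>

lemma shortest_curve_plane_subset_segment:
  assumes "shortest_curve UNIV A B g"
  shows "path_image g \<subseteq> closed_segment A B"
proof
  let ?N = "\<lambda>t. norm (vector_derivative g (at t))"
  have g: "piecewise_C2 g" "g 0 = A" "g 1 = B"
    using assms unfolding shortest_curve_def curve_in_def pathstart_def pathfinish_def by auto
  have rect: "rectifiable_on 0 1 g" using g(1) by (rule piecewise_C2_rectifiable)
  have "curve_length g \<le> curve_length (linepath A B)"
    using assms curve_in_linepath unfolding shortest_curve_def by blast
  also have "\<dots> = dist A B" by (simp add: curve_length_def dist_norm norm_minus_commute)
  finally have len: "integral {0..1} ?N \<le> dist A B" by (simp add: curve_length_def)
  fix p assume "p \<in> path_image g"
  then obtain t where t: "0 \<le> t" "t \<le> 1" "p = g t" by (auto simp: path_image_def)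
  have "dist p A \<le> integral {0..t} ?N" "dist B p \<le> integral {t..1} ?N"
    using rect t g(2,3) unfolding rectifiable_on_def dist_norm by (metis order_refl)+
  then have "dist A p + dist p B \<le> integral {0..t} ?N + integral {t..1} ?N"
    by (simp add: dist_commute add_mono)
  also have "\<dots> = integral {0..1} ?N"
    using rect t unfolding rectifiable_on_def by (intro Henstock_Kurzweil_Integration.integral_combine) auto
  finally have "dist A p + dist p B \<le> dist A B" using len by simp
  then have "dist A B = dist A p + dist p B" using dist_triangle[of A B p] by simp
  then show "p \<in> closed_segment A B" using between between_mem_segment by metis
qed

text \<open>A connected collinear set is convex. Convexity, unlike connectedness, survives
  intersection with a convex cell.\<close>

lemma shortest_curve_plane_convex:
  assumes "shortest_curve UNIV A B g"
  shows "convex (path_image g)"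
proof -
  have "collinear (path_image g)"
    using shortest_curve_plane_subset_segment[OF assms] collinear_subset collinear_closed_segment by blast
  moreover have "connected (path_image g)"
    using assms unfolding shortest_curve_def curve_in_def piecewise_C2_def
    by (simp add: path_def[symmetric] connected_path_image)
  ultimately show ?thesis using convex_connected_collinear by blast
qed

lemma finiteness_property_plane:
  assumes "\<And>e. e \<in> \<A> \<Longrightarrow> convex e"
  shows "finiteness_property UNIV \<A>"
  unfolding finiteness_property_def
proof (intro ballI allI impI disjI2)
  fix A B :: "real \<times> real" and g e
  assume sc: "shortest_curve UNIV A B g" and e: "e \<in> \<A>"
  define K where "K = path_image g \<inter> e"
  have "connected K" unfolding K_def
    using shortest_curve_plane_convex[OF sc] assms[OF e] by (intro convex_connected convex_Int)
  \<comment> \<open>A connected set has at most itself as a component, and the empty set has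
    none.\<close>
  then have comp: "components K \<subseteq> {K}" using connected_eq_connected_components_eq components_eq_sing_iff
    by (metis Diff_cancel components_empty empty_subsetI subset_refl)
  have sub: "K \<subseteq> closed_segment A B" unfolding K_def using shortest_curve_plane_subset_segment[OF sc] by blast
  have "(\<exists>p. K = {p}) \<or> geodesic_segment \<A> K" if "K \<noteq> {}"
  proof (cases "\<exists>p. K \<subseteq> {p}")
    case True
    then show ?thesis using that by blast
  next
    case False
    have "A \<noteq> B"
    proof
      assume "A = B"
      then have "K \<subseteq> {A}" using sub by (simp only: closed_segment_idem)
      then show False using False by blast
    qed
    moreover have "K \<subseteq> {A + t *\<^sub>R (B - A) | t. True}"
    proof
      fix p assume "p \<in> K"
      then obtain t where "p = (1 - t) *\<^sub>R A + t *\<^sub>R B" using sub unfolding closed_segment_def by blast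
      then have "p = A + t *\<^sub>R (B - A)" by (simp add: algebra_simps)
      then show "p \<in> {A + t *\<^sub>R (B - A) | t. True}" by blast
    qed
    ultimately show ?thesis using \<open>connected K\<close> False unfolding geodesic_segment_def by blast
  qed
  then show "finite (components (path_image g \<inter> e)) \<and>
     (\<forall>C\<in>components (path_image g \<inter> e). (\<exists>p. C = {p}) \<or> geodesic_segment \<A> C)"
    unfolding K_def[symmetric]
    using comp finite_subset[OF comp] in_components_nonempty by blast
qed

subsection \<open>The integer grid\<close>

text \<open>A homeomorphism of the closed ball onto the body exists; invariance of domain, applied
  to it and to its inverse, shows that it matches interior with interior and hence boundary with
  boundary.\<close>

lemma homeomorphism_cball_convex_body:
  fixes S :: "'a::euclidean_space set"
  assumes "convex S" "compact S" "interior S \<noteq> {}"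
  obtains f g where "homeomorphism (cball (0::'a) 1) S f g" "f ` ball 0 1 = interior S"
    "f ` sphere 0 1 = S - interior S"
proof -
  have "S homeomorphic cball (0::'a) 1" by (rule homeomorphic_convex_compact_cball[OF assms zero_less_one])
  then obtain f g where fg: "homeomorphism (cball (0::'a) 1) S f g"
    using homeomorphic_sym unfolding homeomorphic_def by blast
  have inj: "inj_on f (cball 0 1)" "inj_on g S"
    using fg by (auto simp: homeomorphism_def intro: inj_on_inverseI)
  have cont: "continuous_on (cball 0 1) f" "continuous_on S g"
    and im: "f ` cball 0 1 = S" "g ` S = cball 0 1"
    using fg by (auto simp: homeomorphism_def)
  have "open (f ` ball 0 1)"
    using cont inj by (intro invariance_of_domain) (auto intro: continuous_on_subset inj_on_subset)
  then have 1: "f ` ball 0 1 \<subseteq> interior S"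
    using im by (intro interior_maximal) auto
  have "open (g ` interior S)"
    using cont inj interior_subset[of S]
    by (intro invariance_of_domain) (auto intro: continuous_on_subset inj_on_subset)
  then have "g ` interior S \<subseteq> interior (cball 0 1)"
    using image_mono[OF interior_subset[of S], of g] unfolding im(2) by (intro interior_maximal)
  then have 2: "g ` interior S \<subseteq> ball 0 1" unfolding interior_cball .
  have "interior S \<subseteq> f ` ball 0 1"
  proof
    fix x assume x: "x \<in> interior S"
    then have "f (g x) = x" using interior_subset[of S] by (intro homeomorphism_apply2[OF fg]) blast
    then show "x \<in> f ` ball 0 1" using 2 x by (metis imageI subsetD)
  qed
  then have b: "f ` ball 0 1 = interior S" using 1 by blast
  have "sphere 0 1 = cball (0::'a) 1 - ball 0 1" by auto
  then have "f ` sphere 0 1 = f ` cball 0 1 - f ` ball 0 1"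
    using inj_on_image_set_diff[OF inj(1), of "cball 0 1" "ball 0 1"] by simp
  then show ?thesis using that fg b im by simp
qed

section \<open>Cells of the grid\<close>

text \<open>Cells are indexed by points: a cell is the cell of each of its points
  (\<open>unit_cell_eq\<close>), which gives disjointness of the grid at once.\<close>

definition unit_cell :: "real \<Rightarrow> real set" where
  "unit_cell x = (if x \<in> \<int> then {x} else {of_int \<lfloor>x\<rfloor><..<of_int \<lfloor>x\<rfloor> + 1})"

definition grid_cell :: "real \<times> real \<Rightarrow> (real \<times> real) set" where
  "grid_cell p = unit_cell (fst p) \<times> unit_cell (snd p)"

lemma mem_unit_cell: "x \<in> unit_cell x"
proof (cases "x \<in> \<int>")
  case False
  then have "of_int \<lfloor>x\<rfloor> \<noteq> x" by (metis Ints_of_int)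
  then have "of_int \<lfloor>x\<rfloor> < x" using of_int_floor_le[of x] by linarith
  then show ?thesis using False by (simp add: unit_cell_def)
qed (simp add: unit_cell_def)

lemma unit_cell_cases:
  obtains "x \<in> \<int>" "unit_cell x = {x}"
  | m :: int where "unit_cell x = {of_int m<..<of_int m + 1}"
proof (cases "x \<in> \<int>")
  case True
  then show ?thesis using that(1) by (simp add: unit_cell_def)
next
  case False
  then show ?thesis using that(2)[of "\<lfloor>x\<rfloor>"] by (simp add: unit_cell_def)
qed

lemma unit_cell_eq:
  assumes "y \<in> unit_cell x"
  shows "unit_cell y = unit_cell x"
proof (cases "x \<in> \<int>")
  case False
  then have y: "of_int \<lfloor>x\<rfloor> < y" "y < of_int \<lfloor>x\<rfloor> + 1" using assms by (simp_all add: unit_cell_def)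
  then have fl: "\<lfloor>y\<rfloor> = \<lfloor>x\<rfloor>" by (intro floor_unique) auto
  have "y \<notin> \<int>"
  proof
    assume "y \<in> \<int>"
    then have "of_int \<lfloor>y\<rfloor> = y" by (auto elim: Ints_cases)
    then show False using y fl by simp
  qed
  then show ?thesis using False fl by (simp add: unit_cell_def)
qed (use assms in \<open>auto simp: unit_cell_def\<close>)

lemma mem_grid_cell: "p \<in> grid_cell p"
  by (simp add: grid_cell_def mem_unit_cell mem_Times_iff)

lemma grid_cell_eq: "q \<in> grid_cell p \<Longrightarrow> grid_cell q = grid_cell p"
  unfolding grid_cell_def mem_Times_iff
  using unit_cell_eq[of "fst q" "fst p"] unit_cell_eq[of "snd q" "snd p"] by simp

lemma finite_unit_cells: "finite (unit_cell ` {-r..r})"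
proof (rule finite_subset)
  show "unit_cell ` {-r..r} \<subseteq> (\<lambda>n. {of_int n}) ` {\<lfloor>-r\<rfloor>..\<lfloor>r\<rfloor>} \<union>
     (\<lambda>n. {of_int n<..<of_int n + 1}) ` {\<lfloor>-r\<rfloor>..\<lfloor>r\<rfloor>}"
  proof
    fix e assume "e \<in> unit_cell ` {-r..r}"
    then obtain x where x: "e = unit_cell x" "-r \<le> x" "x \<le> r" by auto
    have "\<lfloor>x\<rfloor> \<in> {\<lfloor>-r\<rfloor>..\<lfloor>r\<rfloor>}" using floor_mono[OF x(2)] floor_mono[OF x(3)] by simp
    moreover have "e = {of_int \<lfloor>x\<rfloor>} \<or> e = {of_int \<lfloor>x\<rfloor><..<of_int \<lfloor>x\<rfloor> + 1}"
      unfolding x(1) unit_cell_def by (auto elim: Ints_cases)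
    ultimately show "e \<in> (\<lambda>n. {of_int n}) ` {\<lfloor>-r\<rfloor>..\<lfloor>r\<rfloor>} \<union>
     (\<lambda>n. {of_int n<..<of_int n + 1}) ` {\<lfloor>-r\<rfloor>..\<lfloor>r\<rfloor>}" by blast
  qed
qed simp

lemma locally_finite_grid: "locally_finite_cells (range grid_cell)"
  unfolding locally_finite_cells_def
proof
  fix r
  let ?F = "unit_cell ` {-r..r}"
  show "finite {e \<in> range grid_cell. e \<inter> cball 0 r \<noteq> {}}"
  proof (rule finite_subset)
    show "{e \<in> range grid_cell. e \<inter> cball 0 r \<noteq> {}} \<subseteq> (\<lambda>(a, b). a \<times> b) ` (?F \<times> ?F)"
    proof
      fix e assume "e \<in> {e \<in> range grid_cell. e \<inter> cball 0 r \<noteq> {}}"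
      then obtain p q where "e = grid_cell p" "q \<in> grid_cell p" "norm q \<le> r" by force
      then have q: "e = grid_cell q" "norm q \<le> r" using grid_cell_eq by simp_all
      have "\<bar>fst q\<bar> \<le> r" "\<bar>snd q\<bar> \<le> r"
        using norm_fst_le[of "fst q" "snd q"] norm_snd_le[of "snd q" "fst q"] q(2) by simp_all
      then have "unit_cell (fst q) \<in> ?F" "unit_cell (snd q) \<in> ?F" by (auto simp: abs_le_iff)
      then show "e \<in> (\<lambda>(a, b). a \<times> b) ` (?F \<times> ?F)"
        unfolding q(1) grid_cell_def by (intro image_eqI[of _ _ "(unit_cell (fst q), unit_cell (snd q))"]) simp_all
    qed
    show "finite ((\<lambda>(a, b). a \<times> b) ` (?F \<times> ?F))"
      by (intro finite_imageI finite_cartesian_product finite_unit_cells)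
  qed
qed

lemma convex_unit_cell: "convex (unit_cell x)" and bounded_unit_cell: "bounded (unit_cell x)"
  by (simp_all add: unit_cell_def)

lemma semialg_grid_cell: "semialg (grid_cell p)"
proof -
  have "semialg {q. fst q \<in> unit_cell x}" for x
  proof (cases x rule: unit_cell_cases)
    case 1
    then show ?thesis using semialg_halfplanes(5)[of x] by simp
  next
    case (2 m)
    then show ?thesis
      using semialg_Int[OF semialg_halfplanes(1)[of "of_int m"] semialg_halfplanes(2)[of "of_int m + 1"]]
      by (simp add: Int_def)
  qed
  moreover have "semialg {q. snd q \<in> unit_cell x}" for x
  proof (cases x rule: unit_cell_cases)
    case 1
    then show ?thesis using semialg_halfplanes(6)[of x] by simp
  next
    case (2 m)
    then show ?thesis
      using semialg_Int[OF semialg_halfplanes(3)[of "of_int m"] semialg_halfplanes(4)[of "of_int m + 1"]]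
      by (simp add: Int_def)
  qed
  moreover have "grid_cell p = {q. fst q \<in> unit_cell (fst p)} \<inter> {q. snd q \<in> unit_cell (snd p)}"
    by (auto simp: grid_cell_def)
  ultimately show ?thesis using semialg_Int by metis
qed

lemma grid_vertex:
  assumes "x \<in> \<int>" "y \<in> \<int>"
  shows "{(x, y)} \<in> range grid_cell"
proof -
  have "grid_cell (x, y) = {(x, y)}" using assms by (simp add: grid_cell_def unit_cell_def)
  then show ?thesis by (metis rangeI)
qed

lemma horizontal_edge_arc:
  assumes "y \<in> \<int>"
  shows "cell_arc {p. {p} \<in> range grid_cell} ({real_of_int m<..<real_of_int m + 1} \<times> {y})
    (\<lambda>t. (of_int m + (t + 1) / 2, y))"
  unfolding cell_arc_def
proof (intro conjI exI[of _ "\<lambda>p. 2 * (fst p - of_int m) - 1"])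
  show "homeomorphism {-1<..<1} ({real_of_int m<..<real_of_int m + 1} \<times> {y})
     (\<lambda>t. (of_int m + (t + 1) / 2, y)) (\<lambda>p. 2 * (fst p - of_int m) - 1)"
    by (rule homeomorphismI) (auto intro!: continuous_intros simp: field_simps)
qed (use assms grid_vertex in \<open>auto intro!: continuous_intros\<close>)

lemma vertical_edge_arc:
  assumes "x \<in> \<int>"
  shows "cell_arc {p. {p} \<in> range grid_cell} ({x} \<times> {real_of_int m<..<real_of_int m + 1})
    (\<lambda>t. (x, of_int m + (t + 1) / 2))"
  unfolding cell_arc_def
proof (intro conjI exI[of _ "\<lambda>p. 2 * (snd p - of_int m) - 1"])
  show "homeomorphism {-1<..<1} ({x} \<times> {real_of_int m<..<real_of_int m + 1})
     (\<lambda>t. (x, of_int m + (t + 1) / 2)) (\<lambda>p. 2 * (snd p - of_int m) - 1)"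
    by (rule homeomorphismI) (auto intro!: continuous_intros simp: field_simps)
qed (use assms grid_vertex in \<open>auto intro!: continuous_intros\<close>)

lemma grid_cell_cases:
  obtains "grid_cell p = {p}"
  | \<Phi> where "cell_arc {p. {p} \<in> range grid_cell} (grid_cell p) \<Phi>"
  | m n :: int where "grid_cell p = {real_of_int m<..<real_of_int m + 1} \<times> {real_of_int n<..<real_of_int n + 1}"
proof (cases "fst p" rule: unit_cell_cases)
  case 1
  show ?thesis
  proof (cases "snd p" rule: unit_cell_cases)
    case snd: 1
    have "grid_cell p = {fst p} \<times> {snd p}" using 1 snd by (simp add: grid_cell_def)
    then show ?thesis using that(1) by simp
  next
    case (2 n)
    then show ?thesis using 1 vertical_edge_arc[OF 1(1), of n] that(2) by (simp add: grid_cell_def)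
  qed
next
  case m: (2 m)
  show ?thesis
  proof (cases "snd p" rule: unit_cell_cases)
    case 1
    then show ?thesis using m horizontal_edge_arc[OF 1(1), of m] that(2) by (simp add: grid_cell_def)
  next
    case (2 n)
    then show ?thesis using m that(3) by (simp add: grid_cell_def)
  qed
qed

text \<open>An open square contains no point with an integer coordinate. This places the boundary of
  a square in the 1-skeleton.\<close>

lemma grid_point_with_integer_coordinate:
  assumes "fst p \<in> \<int> \<or> snd p \<in> \<int>"
  shows "is_0cell (grid_cell p) \<or> is_1cell (grid_cell p)"
proof (cases p rule: grid_cell_cases)
  case (3 m n)
  have "p \<in> grid_cell p" by (rule mem_grid_cell)
  then have "fst p \<in> {real_of_int m<..<real_of_int m + 1}" "snd p \<in> {real_of_int n<..<real_of_int n + 1}"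
    using 3 by (auto simp: mem_Times_iff)
  moreover have "x \<notin> \<int>" if "x \<in> {real_of_int k<..<real_of_int k + 1}" for x k
  proof
    assume "x \<in> \<int>"
    then obtain j where "x = real_of_int j" by (auto elim: Ints_cases)
    then show False using that by auto
  qed
  ultimately show ?thesis using assms by blast
qed (auto simp: is_0cell_def dest: cell_arc_is_1cell)

text \<open>The characteristic map is a homeomorphism of the closed disk onto the closed square,
  whose points off the open square have an integer coordinate.\<close>

lemma open_square_cell:
  fixes m n :: int
  defines "e \<equiv> {real_of_int m<..<real_of_int m + 1} \<times> {real_of_int n<..<real_of_int n + 1}"
  obtains \<Phi> :: "real \<times> real \<Rightarrow> real \<times> real" and \<Psi> where
    "continuous_on (cball 0 1) \<Phi>" "homeomorphism (ball 0 1) e \<Phi> \<Psi>"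
    "\<Phi> ` sphere 0 1 \<subseteq> \<Union>{e' \<in> range grid_cell. is_0cell e' \<or> is_1cell e'}"
proof -
  define S where "S = {real_of_int m..real_of_int m + 1} \<times> {real_of_int n..real_of_int n + 1}"
  have int: "interior S = e"
    unfolding S_def e_def by (simp add: interior_Times)
  have "convex S" "compact S" unfolding S_def by (auto intro!: convex_Times compact_Times)
  moreover have "interior S \<noteq> {}" unfolding int e_def by auto
  ultimately obtain f g where fg: "homeomorphism (cball (0::real \<times> real) 1) S f g"
    "f ` ball 0 1 = interior S" "f ` sphere 0 1 = S - interior S"
    by (rule homeomorphism_cball_convex_body)
  have "homeomorphism (ball 0 1) e f g"
    by (rule homeomorphism_of_subsets[OF fg(1)]) (use fg(2) int interior_subset[of S] in auto)
  moreover have "continuous_on (cball 0 1) f" using fg(1) by (simp add: homeomorphism_def)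
  moreover have "f ` sphere 0 1 \<subseteq> \<Union>{e' \<in> range grid_cell. is_0cell e' \<or> is_1cell e'}"
  proof
    fix p assume "p \<in> f ` sphere 0 1"
    then have "p \<in> S - e" using fg(3) int by simp
    then have "fst p \<in> {real_of_int m, real_of_int m + 1} \<or> snd p \<in> {real_of_int n, real_of_int n + 1}"
      unfolding S_def e_def by (cases p) auto
    then have "fst p \<in> \<int> \<or> snd p \<in> \<int>" by auto
    then show "p \<in> \<Union>{e' \<in> range grid_cell. is_0cell e' \<or> is_1cell e'}"
      using grid_point_with_integer_coordinate mem_grid_cell by blast
  qed
  ultimately show ?thesis using that by blast
qed

lemma open_square_is_2cell:
  "is_2cell ({real_of_int m<..<real_of_int m + 1} \<times> {real_of_int n<..<real_of_int n + 1})"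
proof -
  obtain \<Phi> :: "real \<times> real \<Rightarrow> real \<times> real" and \<Psi> where
    "homeomorphism (ball 0 1) ({real_of_int m<..<real_of_int m + 1} \<times> {real_of_int n<..<real_of_int n + 1}) \<Phi> \<Psi>"
    using open_square_cell by metis
  then show ?thesis unfolding is_2cell_def using homeomorphic_def homeomorphic_sym by blast
qed

lemma cell_decomposition_grid: "cell_decomposition UNIV (range grid_cell)"
  unfolding cell_decomposition_def
proof (intro conjI ballI)
  show ne: "{} \<notin> range grid_cell" using mem_grid_cell by fastforce
  show "countable (range grid_cell)" by (rule locally_finite_cells_countable[OF locally_finite_grid ne])
  show "disjoint (range grid_cell)"
    unfolding disjoint_def using grid_cell_eq by blast
  show "\<Union>(range grid_cell) = UNIV" using mem_grid_cell by blast
  fix e assume "e \<in> range grid_cell"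
  then obtain p where p: "e = grid_cell p" by blast
  show "semialg e" unfolding p by (rule semialg_grid_cell)
  show "is_0cell e \<or> is_1cell e \<or> is_2cell e"
    unfolding p
    by (cases p rule: grid_cell_cases) (auto simp: is_0cell_def open_square_is_2cell dest: cell_arc_is_1cell)
qed

lemma cw_complex_grid: "cw_complex UNIV (range grid_cell)"
proof -
  have bd: "bounded e" if "e \<in> range grid_cell" for e
    using that bounded_Times[OF bounded_unit_cell bounded_unit_cell] by (auto simp: grid_cell_def)
  have 1: "\<exists>\<Phi> :: real \<Rightarrow> real \<times> real. continuous_on {-1..1} \<Phi> \<and> \<Phi> ` {-1..1} \<subseteq> UNIV \<and>
           (\<exists>\<Psi>. homeomorphism {-1<..<1} e \<Phi> \<Psi>) \<and>
           \<Phi> ` {-1, 1} \<subseteq> \<Union>{e'\<in>range grid_cell. is_0cell e'}"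
    if e: "e \<in> range grid_cell" "is_1cell e" for e
  proof -
    obtain p where p: "e = grid_cell p" using e by blast
    \<comment> \<open>Of the three shapes of a grid cell only an edge can be a 1-cell, the types
      being exclusive.\<close>
    obtain \<Phi> where \<Phi>: "cell_arc {p. {p} \<in> range grid_cell} e \<Phi>"
    proof (cases p rule: grid_cell_cases)
      case 1
      then show ?thesis using e is_0cell_not_1cell unfolding p is_0cell_def by blast
    next
      case (3 m n)
      then show ?thesis using e is_1cell_not_2cell open_square_is_2cell unfolding p by metis
    qed (use that p in blast)
    have "{p. {p} \<in> range grid_cell} \<subseteq> \<Union>{e'\<in>range grid_cell. is_0cell e'}"
      unfolding is_0cell_def by blast
    then show ?thesis using \<Phi> unfolding cell_arc_def by (intro exI[of _ \<Phi>]) blast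
  qed
  have 2: "\<exists>\<Phi> :: real \<times> real \<Rightarrow> real \<times> real. continuous_on (cball 0 1) \<Phi> \<and> \<Phi> ` cball 0 1 \<subseteq> UNIV \<and>
           (\<exists>\<Psi>. homeomorphism (ball 0 1) e \<Phi> \<Psi>) \<and>
           \<Phi> ` sphere 0 1 \<subseteq> \<Union>{e'\<in>range grid_cell. is_0cell e' \<or> is_1cell e'}"
    if e: "e \<in> range grid_cell" "is_2cell e" for e
  proof -
    obtain p where p: "e = grid_cell p" using e by blast
    obtain m n where "e = {real_of_int m<..<real_of_int m + 1} \<times> {real_of_int n<..<real_of_int n + 1}"
    proof (cases p rule: grid_cell_cases)
      case 1
      then show ?thesis using e is_0cell_not_2cell unfolding p is_0cell_def by blast
    next
      case 2
      then show ?thesis using e is_1cell_not_2cell cell_arc_is_1cell unfolding p by blast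
    qed (use that p in blast)
    then obtain \<Phi> :: "real \<times> real \<Rightarrow> real \<times> real" and \<Psi> where
      "continuous_on (cball 0 1) \<Phi>" "homeomorphism (ball 0 1) e \<Phi> \<Psi>"
      "\<Phi> ` sphere 0 1 \<subseteq> \<Union>{e' \<in> range grid_cell. is_0cell e' \<or> is_1cell e'}"
      using open_square_cell[of m n] by blast
    then show ?thesis by (intro exI[of _ \<Phi>] conjI exI[of _ \<Psi>] subset_UNIV)
  qed
  have "\<Union>(range grid_cell) = UNIV" using mem_grid_cell by blast
  note tail = locally_finite_cells_cw[OF locally_finite_grid closed_UNIV this bd]
  show ?thesis
    unfolding cw_complex_def
    by (intro conjI; (rule cell_decomposition_grid | rule tail |
      (rule ballI, rule impI, rule 1; assumption) | (rule ballI, rule impI, rule 2; assumption)))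
qed

lemma finiteness_property_grid: "finiteness_property UNIV (range grid_cell)"
proof (rule finiteness_property_plane)
  fix e assume "e \<in> range grid_cell"
  then show "convex e" using convex_Times[OF convex_unit_cell convex_unit_cell] by (auto simp: grid_cell_def)
qed

theorem theorem2p8:
  fixes k :: nat and f :: "nat \<Rightarrow> real \<times> real \<Rightarrow> real"
  assumes "\<forall>i<k. is_poly2 (f i)"
  shows "\<exists>\<A>. cell_decomposition {p. \<forall>i<k. f i p = 0} \<A> \<and>
              finiteness_property {p. \<forall>i<k. f i p = 0} \<A> \<and>
              cw_complex {p. \<forall>i<k. f i p = 0} \<A>"
proof (cases "{p. \<forall>i<k. f i p = 0} = UNIV")
  \<comment> \<open>This covers \<open>k = 0\<close> and a system of zero polynomials.\<close>
  case True
  then show ?thesis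
    using cell_decomposition_grid finiteness_property_grid cw_complex_grid by (simp only:) blast
next
  case False
  have "\<exists>P. \<forall>x y. f i (x, y) = ev P x y" if "i < k" for i
    using is_poly2_imp_ev[of "f i"] assms that by metis
  then obtain P where P: "\<And>i x y. i < k \<Longrightarrow> f i (x, y) = ev (P i) x y" by metis
  \<comment> \<open>Over the reals a sum of squares vanishes exactly where all its terms do, so one
    equation replaces the system.\<close>
  define F where "F = (\<Sum>i<k. P i ^ 2)"
  have zero: "ev F x y = 0 \<longleftrightarrow> (\<forall>i<k. f i (x, y) = 0)" for x y
    unfolding F_def ev_sum by (simp add: sum_nonneg_eq_0_iff P Ball_def)
  then have X: "{p. ev F (fst p) (snd p) = 0} = {p. \<forall>i<k. f i p = 0}" by auto
  obtain q where "q \<notin> {p. ev F (fst p) (snd p) = 0}" using False X by blast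
  then have "ev F (fst q) (snd q) \<noteq> 0" by simp
  then obtain \<A> where "graph_decomposition {p. \<forall>i<k. f i p = 0} \<A>"
    using graph_decomposition_zero_set X by metis
  then show ?thesis
    using graph_decomposition_cell_decomposition graph_decomposition_finiteness_property
      graph_decomposition_cw_complex by blast
qed

end
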